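(* There is an absolute constant $c$ such that for every integer $k\ge 2$ the following holds. Let $G=(V,E)$ be an $n$-vertex (not necessarily simple) $k$-quasi-planar topological graph whose edges are drawn as $x$-monotone curves. Then $|E(G)| \leq 2^{ck^3}\, n\log n$.
   Context: A topological graph is a graph drawn in the plane with vertices represented by distinct points and edges represented by non-self-intersecting arcs connecting the corresponding points; arcs do not pass through vertices other than their endpoints, and if two edges share an interior point they properly cross there (no tangencies). There are no parallel edges or self-loops. Two edges cross if their interiors share a point; edges may cross each other any number of times. A topological graph is $k$-quasi-planar if it does not contain $k$ pairwise crossing edges. A curve is $x$-monotone if every vertical line meets it in at most one point. *)

theory Defs
  imports "HOL-Analysis.Analysis"
begin

type_synonym point = "real \<times> real"

definition arc_interior :: "(real \<Rightarrow> point) \<Rightarrow> point set" where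
  "arc_interior g = g ` {0<..<1}"

text \<open>
  Two curves cross properly at a common point if, in suitable local coordinates around it, they
  look like the two coordinate axes. The common point is then necessarily sent to the origin and
  is the only common point of the curves in the neighbourhood \<open>U\<close>; touchings, overlaps, and
  endpoints lying on the other curve are excluded.
\<close>

definition properly_cross_at :: "point set \<Rightarrow> point set \<Rightarrow> point \<Rightarrow> bool" where
  "properly_cross_at A B p \<longleftrightarrow>
     (\<exists>U h h'. open U \<and> p \<in> A \<inter> B \<inter> U \<and> homeomorphism U (UNIV :: point set) h h' \<and>
        h ` (A \<inter> U) = {q. snd q = 0} \<and> h ` (B \<inter> U) = {q. fst q = 0})"

text \<open>
  The vertices are identified with the points representing them, and an edge with the unordered
  pair of its endpoints; so there are no loops and no parallel edges. The arc representing the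
  edge \<open>e\<close> is \<open>\<gamma> e\<close>, whose orientation is irrelevant. Two edges may share any number of interior
  points.
\<close>

definition topological_graph ::
    "point set \<Rightarrow> point set set \<Rightarrow> (point set \<Rightarrow> real \<Rightarrow> point) \<Rightarrow> bool" where
  "topological_graph V E \<gamma> \<longleftrightarrow>
     finite V \<and>
     (\<forall>e\<in>E. e \<subseteq> V \<and> card e = 2) \<and>
     (\<forall>e\<in>E. arc (\<gamma> e) \<and> {pathstart (\<gamma> e), pathfinish (\<gamma> e)} = e \<and>
             path_image (\<gamma> e) \<inter> V = e) \<and>
     (\<forall>e\<in>E. \<forall>f\<in>E. e \<noteq> f \<longrightarrow>
        (\<forall>p \<in> arc_interior (\<gamma> e) \<inter> arc_interior (\<gamma> f).
           properly_cross_at (path_image (\<gamma> e)) (path_image (\<gamma> f)) p))"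

definition edges_cross ::
    "(point set \<Rightarrow> real \<Rightarrow> point) \<Rightarrow> point set \<Rightarrow> point set \<Rightarrow> bool" where
  "edges_cross \<gamma> e f \<longleftrightarrow> arc_interior (\<gamma> e) \<inter> arc_interior (\<gamma> f) \<noteq> {}"

definition quasi_planar ::
    "nat \<Rightarrow> point set set \<Rightarrow> (point set \<Rightarrow> real \<Rightarrow> point) \<Rightarrow> bool" where
  "quasi_planar k E \<gamma> \<longleftrightarrow> \<not> (\<exists>F\<subseteq>E. card F = k \<and> pairwise (edges_cross \<gamma>) F)"

definition x_monotone :: "point set \<Rightarrow> bool" where
  "x_monotone C \<longleftrightarrow> (\<forall>a. \<forall>p\<in>C. \<forall>q\<in>C. fst p = a \<and> fst q = a \<longrightarrow> p = q)"

end

theory Submission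
  imports Defs
begin

text \<open>
  Split the vertices by a vertical line through a median abscissa; the edges meeting it strictly cross
  one of two nearby vertical lines free of vertices, so it suffices to bound linearly the number of
  edges crossing a vertical line. With \<open>q = k - 1\<close>, Mirsky's theorem allows us, at the cost of a
  factor \<open>q\<^sup>2\<close>, to assume that edges with the same right end do not cross to the right of the line,
  and likewise on the left. Order the edges by their height on the line. If the right ends of edges
  at increasing positions read \<open>w\<^sub>1 \<dots> w\<^sub>l w\<^sub>l \<dots> w\<^sub>1 w\<^sub>1 \<dots> w\<^sub>l\<close>, then \<open>l \<le> q\<^sup>3\<close>. On the other hand,
  sequences without such a pattern, built of blocks without repetitions, have length
  \<open>2\<^bsup>O(l)\<^esup>\<close> times the number of letters and blocks. As the graph has no parallel edges, a block of
  \<open>Q\<^sup>2\<close> consecutive edges has at least \<open>Q\<close> distinct ends in total on the two sides, which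
  gives the linear bound with a factor \<open>2\<^bsup>O(k^3)\<^esup>\<close>.
\<close>

subsection \<open>Nested pairs in ordered incidences\<close>

text \<open>\<open>A\<close> is a 0-1 matrix with rows (letters) \<open>U\<close> and columns
  \<open>{..<M}\<close>; the injective \<open>d\<close> orders the rows linearly. A column stands
  for a block of a sequence, an incidence for a letter occurring in it.\<close>

locale ordered_incidence =
  fixes A :: "('a \<times> nat) set" and U :: "'a set" and M :: nat and d :: "'a \<Rightarrow> nat"
  assumes finU: "finite U" and sub: "A \<subseteq> U \<times> {..<M}" and inj_d: "inj_on d U"
begin

definition cols :: "'a \<Rightarrow> nat set" where "cols a = {p. (a, p) \<in> A}"

definition col :: "'a \<Rightarrow> nat \<Rightarrow> nat" where "col a i = sorted_list_of_set (cols a) ! i"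

lemma finite_cols [simp]: "finite (cols a)"
  by (rule finite_subset[of _ "{..<M}"]) (use sub in \<open>auto simp: cols_def\<close>)

lemma col_in: "i < card (cols a) \<Longrightarrow> (a, col a i) \<in> A"
  using nth_mem[of i "sorted_list_of_set (cols a)"] by (simp add: col_def cols_def[symmetric])
    (simp add: cols_def)

lemma col_less: "i < j \<Longrightarrow> j < card (cols a) \<Longrightarrow> col a i < col a j"
  using sorted_wrt_nth_less[OF strict_sorted_list_of_set, of i j "cols a"] by (simp add: col_def)

lemma col_less_iff: "i < card (cols a) \<Longrightarrow> j < card (cols a) \<Longrightarrow> col a i < col a j \<longleftrightarrow> i < j"
  by (metis col_less not_less_iff_gr_or_eq)

lemma col_mono: "i \<le> j \<Longrightarrow> j < card (cols a) \<Longrightarrow> col a i \<le> col a j"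
  by (metis col_less le_eq_less_or_eq)

lemma col_eq_iff: "i < card (cols a) \<Longrightarrow> j < card (cols a) \<Longrightarrow> col a i = col a j \<longleftrightarrow> i = j"
  by (metis col_less not_less_iff_gr_or_eq)

text \<open>
  The columns of a letter are cut into chunks of twelve consecutive ones, and each chunk into four
  quarters of three. An incomplete last chunk is dropped. Of the three columns of a quarter contained
  in the span of a good chunk, the last two lie strictly to the right of the chunk's first column.
\<close>

definition chunks :: "('a \<times> nat) set" where
  "chunks = (SIGMA a:U. {..<card (cols a) div 12})"

definition span :: "'a \<times> nat \<Rightarrow> nat set" where
  "span c = {col (fst c) (12 * snd c)..col (fst c) (12 * snd c + 11)}"

definition quarter :: "'a \<times> nat \<Rightarrow> nat \<Rightarrow> nat set" where
  "quarter c h = {col (fst c) (12 * snd c + 3 * h)..col (fst c) (12 * snd c + 3 * h + 2)}"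

definition good :: "'a \<times> nat \<Rightarrow> bool" where
  "good c \<longleftrightarrow> (\<exists>c'\<in>chunks. \<exists>h<4. d (fst c) < d (fst c') \<and> quarter c' h \<subseteq> span c)"

definition bad :: "('a \<times> nat) set" where "bad = {c \<in> chunks. \<not> good c}"

lemma finite_chunks [simp]: "finite chunks"
  by (simp add: chunks_def finU)

lemma chunk_index: "(a, j) \<in> chunks \<Longrightarrow> i < 12 \<Longrightarrow> 12 * j + i < card (cols a)"
  unfolding chunks_def by auto

definition probe :: "('a \<times> nat) \<times> bool \<Rightarrow> nat" where
  "probe x = col (fst (fst x)) (12 * snd (fst x) + (if snd x then 9 else 2))"

definition below :: "('a \<times> nat) \<times> bool \<Rightarrow> ('a \<times> nat) set" where
  "below x = {c \<in> bad. d (fst c) < d (fst (fst x)) \<and> probe x \<in> span c}"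

lemma probe_in_span: "c \<in> chunks \<Longrightarrow> probe (c, s) \<in> span c"
  using chunk_index[of "fst c" "snd c"] chunk_index[of "fst c" "snd c" 11]
  by (simp add: probe_def span_def col_mono)

lemma bad_not_quarter:
  assumes "c \<in> bad" "c' \<in> chunks" "h < 4" "d (fst c) < d (fst c')"
  shows "\<not> (col (fst c) (12 * snd c) \<le> col (fst c') (12 * snd c' + 3 * h) \<and>
            col (fst c') (12 * snd c' + 3 * h + 2) \<le> col (fst c) (12 * snd c + 11))"
proof
  assume "col (fst c) (12 * snd c) \<le> col (fst c') (12 * snd c' + 3 * h) \<and>
            col (fst c') (12 * snd c' + 3 * h + 2) \<le> col (fst c) (12 * snd c + 11)"
  then have "quarter c' h \<subseteq> span c" by (auto simp: quarter_def span_def)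
  with assms show False by (auto simp: bad_def good_def)
qed

text \<open>The span of \<open>c\<close> contains a probe but no quarter of the probed chunk. For
  the probe at index 9, the quarter 6..8 forces it to start after index 6 and the quarter 9..11 to
  stop before index 11. The probe at index 2 is treated likewise with the quarters 0..2 and
  3..5.\<close>

lemma span_below_subset:
  assumes "(b, j) \<in> bad" "c \<in> below ((b, j), s)"
  shows "span c \<subseteq> (if s then {col b (12 * j + 6)<..<col b (12 * j + 11)}
                        else {col b (12 * j)<..<col b (12 * j + 5)})"
proof -
  have c: "c \<in> bad" "d (fst c) < d b" "probe ((b, j), s) \<in> span c"
    using assms by (auto simp: below_def)
  have ch: "(b, j) \<in> chunks" using assms by (auto simp: bad_def)
  note idx = chunk_index[OF ch]
  have nq: "\<not> (col (fst c) (12 * snd c) \<le> col b (12 * j + 3 * h) \<and>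
            col b (12 * j + 3 * h + 2) \<le> col (fst c) (12 * snd c + 11))" if "h < 4" for h
    using bad_not_quarter[OF c(1) ch that] c(2) by simp
  show ?thesis
  proof (cases s)
    case True
    have "col b (12 * j + 8) < col b (12 * j + 9)" "col b (12 * j + 9) < col b (12 * j + 11)"
      by (intro col_less; use idx in simp)+
    moreover have "\<not> (col (fst c) (12 * snd c) \<le> col b (12 * j + 6) \<and>
        col b (12 * j + 8) \<le> col (fst c) (12 * snd c + 11))"
      "\<not> (col (fst c) (12 * snd c) \<le> col b (12 * j + 9) \<and>
        col b (12 * j + 11) \<le> col (fst c) (12 * snd c + 11))"
      using nq[of 2] nq[of 3] by (simp_all add: algebra_simps)
    ultimately show ?thesis using c(3) True by (auto simp: span_def probe_def)
  next
    case False
    have "col b (12 * j + 2) < col b (12 * j + 3)"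
      by (intro col_less; use idx in simp)
    moreover have "\<not> (col (fst c) (12 * snd c) \<le> col b (12 * j) \<and>
        col b (12 * j + 2) \<le> col (fst c) (12 * snd c + 11))"
      "\<not> (col (fst c) (12 * snd c) \<le> col b (12 * j + 3) \<and>
        col b (12 * j + 5) \<le> col (fst c) (12 * snd c + 11))"
      using nq[of 0] nq[of 1] by (simp_all add: algebra_simps)
    ultimately show ?thesis using c(3) False by (auto simp: span_def probe_def)
  qed
qed

text \<open>
  Each bad chunk has two probe columns, the end of its first and the start of its last quarter. A
  probe with nothing below it determines its chunk from the column alone. For any other probe, the
  \<open>d\<close>-largest bad chunk below it contains no quarter of the probed chunk and is therefore
  trapped strictly inside one half of it; maximality makes this assignment injective. Hence
  \<open>2 |bad| \<le> M + |bad|\<close>.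
\<close>

lemma card_bad: "card bad \<le> M"
proof -
  define P where "P = bad \<times> (UNIV :: bool set)"
  define N where "N = {x \<in> P. below x = {}}"
  have finbad: "finite bad" by (simp add: bad_def)
  have badch: "c \<in> chunks" if "c \<in> bad" for c using that by (auto simp: bad_def)
  have fstU: "fst c \<in> U" if "c \<in> bad" for c using badch[OF that] by (auto simp: chunks_def)
  have idx: "12 * j + i < card (cols b)" if "(b, j) \<in> bad" "i < 12" for b j i
    using badch that chunk_index by blast
  have probe_in: "probe (c, s) \<in> span c" if "c \<in> bad" for c s
    using probe_in_span badch that by blast
  have probe_eqD: "j = j' \<and> s = s'"
    if "(b, j) \<in> bad" "(b, j') \<in> bad" "probe ((b, j), s) = probe ((b, j'), s')" for b j j' s s'
  proof -
    have "12 * j + (if s then 9 else 2) = 12 * j' + (if s' then 9 else 2)"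
      using that(3) idx[OF that(1)] idx[OF that(2)] by (subst (asm) probe_def, subst (asm) probe_def)
        (simp add: col_eq_iff split: if_splits)
    then have "12 * j + (if s then 9 else 2) = 12 * j' + (if s' then 9 else 2)" by simp
    then show ?thesis by (cases s; cases s'; simp; presburger)
  qed
  \<comment> \<open>If two such probes coincide, neither letter can have the smaller
    \<open>d\<close>: its chunk contains the common column and would lie below the other
    probe.\<close>
  have "inj_on probe N"
  proof (rule inj_onI)
    fix x x'
    assume xx: "x \<in> N" "x' \<in> N" "probe x = probe x'"
    obtain b j s b' j' s' where x_eq: "x = ((b, j), s)" "x' = ((b', j'), s')"
      by (metis surj_pair)
    note x = xx(1,2)[unfolded x_eq] and eq = xx(3)[unfolded x_eq]
    have bb: "(b, j) \<in> bad" "(b', j') \<in> bad" using x by (auto simp: N_def P_def)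
    have "\<not> d b < d b'"
      using probe_in[OF bb(1), of s] x(2) bb eq by (auto simp: N_def below_def)
    moreover have "\<not> d b' < d b"
      using probe_in[OF bb(2), of s'] x(1) bb eq by (auto simp: N_def below_def)
    ultimately have "b = b'"
      using fstU[OF bb(1)] fstU[OF bb(2)] inj_d by (auto simp: inj_on_def)
    with probe_eqD bb eq show "x = x'" unfolding x_eq by blast
  qed
  moreover have "probe ` N \<subseteq> {..<M}"
  proof -
    have "(b, probe ((b, j), s)) \<in> A" if "(b, j) \<in> bad" for b j s
      using idx[OF that, of "if s then 9 else 2"] unfolding probe_def fst_conv snd_conv
      by (intro col_in) auto
    then show ?thesis using sub by (fastforce simp: N_def P_def)
  qed
  ultimately have cN: "card N \<le> M"
    using card_inj_on_le[of probe N "{..<M}"] by simp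

  have "\<exists>c\<in>below x. \<forall>c'\<in>below x. d (fst c') \<le> d (fst c)" if ne: "below x \<noteq> {}" for x
  proof -
    have fin: "finite ((\<lambda>c. d (fst c)) ` below x)" using finbad by (simp add: below_def)
    then have "Max ((\<lambda>c. d (fst c)) ` below x) \<in> (\<lambda>c. d (fst c)) ` below x"
      using ne by (intro Max_in) auto
    then obtain c where c: "c \<in> below x" "d (fst c) = Max ((\<lambda>c. d (fst c)) ` below x)"
      by (metis imageE)
    have "d (fst c') \<le> d (fst c)" if "c' \<in> below x" for c'
      unfolding c(2) using fin that by (intro Max_ge) auto
    with c(1) show ?thesis by blast
  qed
  then obtain top where top: "\<And>x. below x \<noteq> {} \<Longrightarrow> top x \<in> below x"
    "\<And>x c. below x \<noteq> {} \<Longrightarrow> c \<in> below x \<Longrightarrow> d (fst c) \<le> d (fst (top x))"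
    by metis
  have span_ne: "col (fst c) (12 * snd c) \<in> span c" if "c \<in> bad" for c
    using chunk_index[of "fst c" "snd c" 11] badch[OF that] by (simp add: span_def col_mono)
  have sub_self: "span c \<subseteq> span (b, j)" if "(b, j) \<in> bad" "c \<in> below ((b, j), s)" for b j c s
  proof -
    have "col b (12 * j + 5) < col b (12 * j + 11)" "col b (12 * j) < col b (12 * j + 6)"
      by (intro col_less; use idx[OF that(1)] in simp)+
    then show ?thesis using span_below_subset[OF that] by (fastforce simp: span_def split: if_splits)
  qed
  have "inj_on top (P - N)"
  proof (rule inj_onI)
    fix x x'
    assume xx: "x \<in> P - N" "x' \<in> P - N" "top x = top x'"
    obtain b j s b' j' s' where x_eq: "x = ((b, j), s)" "x' = ((b', j'), s')"
      by (metis surj_pair)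
    note x = xx(1,2)[unfolded x_eq] and eq = xx(3)[unfolded x_eq]
    have bb: "(b, j) \<in> bad" "(b', j') \<in> bad" using x by (auto simp: P_def)
    have ne: "below ((b, j), s) \<noteq> {}" "below ((b', j'), s') \<noteq> {}" using x by (auto simp: N_def)
    define c where "c = top ((b, j), s)"
    have c: "c \<in> below ((b, j), s)" "c \<in> below ((b', j'), s')"
      using top(1)[OF ne(1)] top(1)[OF ne(2)] eq unfolding c_def by metis+
    have cb: "c \<in> bad" using c by (auto simp: below_def)
    have dc: "d (fst c) < d b" "d (fst c) < d b'" "probe ((b, j), s) \<in> span c"
      "probe ((b', j'), s') \<in> span c" using c by (auto simp: below_def)
    \<comment> \<open>The chunk \<open>(b, j)\<close> encloses \<open>c\<close> and hence the other
      probe, so it would lie below that probe with a larger \<open>d\<close> than the maximal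
      \<open>c\<close>.\<close>
    have "\<not> d b < d b'"
    proof
      assume "d b < d b'"
      then have "(b, j) \<in> below ((b', j'), s')"
        using bb dc sub_self[OF bb(1) c(1)] by (auto simp: below_def)
      from top(2)[OF ne(2) this] show False using dc eq by (simp add: c_def)
    qed
    moreover have "\<not> d b' < d b"
    proof
      assume "d b' < d b"
      then have "(b', j') \<in> below ((b, j), s)"
        using bb dc sub_self[OF bb(2) c(2)] by (auto simp: below_def)
      from top(2)[OF ne(1) this] show False using dc eq by (simp add: c_def)
    qed
    ultimately have bb': "b = b'"
      using fstU[OF bb(1)] fstU[OF bb(2)] inj_d by (auto simp: inj_on_def)
    let ?z = "col (fst c) (12 * snd c)"
    have z: "?z \<in> span c" using span_ne cb by simp
    have lo: "col b (12 * j + (if s then 6 else 0)) < ?z"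
      "?z < col b (12 * j + (if s then 11 else 5))"
      using span_below_subset[OF bb(1) c(1)] z by (auto split: if_splits)
    have lo': "col b (12 * j' + (if s' then 6 else 0)) < ?z"
      "?z < col b (12 * j' + (if s' then 11 else 5))"
      using span_below_subset[OF bb(2) c(2)] z bb' by (auto split: if_splits)
    \<comment> \<open>The first column of \<open>c\<close> lies in one half of each chunk; different
      halves of chunks of one letter are disjoint, so the two halves coincide.\<close>
    have ranges: "col b (12 * j + (if s then 6 else 0)) < col b (12 * j' + (if s' then 11 else 5))"
      "col b (12 * j' + (if s' then 6 else 0)) < col b (12 * j + (if s then 11 else 5))"
      using lo lo' by linarith+
    have bnd: "12 * j + (if s then 6 else 0) < card (cols b)"
      "12 * j + (if s then 11 else 5) < card (cols b)"
      "12 * j' + (if s' then 6 else 0) < card (cols b)"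
      "12 * j' + (if s' then 11 else 5) < card (cols b)"
      using idx[OF bb(1), of 11] idx[OF bb(2), of 11] bb' by auto
    have "12 * j + (if s then 6 else 0) < 12 * j' + (if s' then 11 else 5)"
      "12 * j' + (if s' then 6 else 0) < 12 * j + (if s then 11 else 5)"
      using ranges col_less_iff[OF bnd(1,4)] col_less_iff[OF bnd(3,2)] by blast+
    then have "j = j' \<and> s = s'" by (cases s; cases s'; simp; presburger)
    with bb' show "x = x'" by (simp add: x_eq)
  qed
  moreover have "top ` (P - N) \<subseteq> bad"
    using top(1) by (fastforce simp: N_def below_def)
  ultimately have "card (P - N) \<le> card bad"
    using card_inj_on_le finbad by blast
  moreover have "card P = 2 * card bad" by (simp add: P_def card_cartesian_product)
  moreover have "card (P - N) = card P - card N" "card N \<le> card P"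
  proof -
    have "finite P" using finbad by (simp add: P_def)
    moreover have "N \<subseteq> P" by (auto simp: N_def)
    ultimately show "card (P - N) = card P - card N" "card N \<le> card P"
      by (auto intro: card_Diff_subset card_mono finite_subset)
  qed
  ultimately show ?thesis using cN by linarith
qed

text \<open>The middle and last columns of the enclosed quarter serve as \<open>p\<close> and
  \<open>q\<close>. The right inequality stays weak; it becomes strict on comparison with a column
  of a later chunk.\<close>

lemma good_chunk_pair:
  assumes "(a, j) \<in> chunks" "good (a, j)"
  shows "\<exists>b p q. d a < d b \<and> (b, p) \<in> A \<and> (b, q) \<in> A \<and> p < q \<and>
           col a (12 * j) < p \<and> q \<le> col a (12 * j + 11)"
proof -
  obtain b i h where b: "(b, i) \<in> chunks" "h < 4" "d a < d b" "quarter (b, i) h \<subseteq> span (a, j)"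
    using assms by (fastforce simp: good_def)
  have idx: "12 * i + 3 * h + t < card (cols b)" if "t < 3" for t
    using chunk_index[OF b(1), of "3 * h + t"] b(2) that by (simp add: add.assoc)
  have less: "col b (12 * i + 3 * h) < col b (12 * i + 3 * h + 1)"
    "col b (12 * i + 3 * h + 1) < col b (12 * i + 3 * h + 2)"
    using idx[of 1] idx[of 2] by (auto intro!: col_less)
  have "col a (12 * j) \<le> col b (12 * i + 3 * h)" "col b (12 * i + 3 * h + 2) \<le> col a (12 * j + 11)"
    using b(4) less by (auto simp: quarter_def span_def)
  with less b(3) col_in[OF idx[of 1]] col_in[OF idx[of 2]] show ?thesis
    by (intro exI[of _ b] exI[of _ "col b (12 * i + 3 * h + 1)"] exI[of _ "col b (12 * i + 3 * h + 2)"])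
       auto
qed

text \<open>Each letter loses at most 11 incidences in its incomplete last chunk.\<close>

lemma card_incidence: "card A \<le> 12 * card chunks + 11 * card U"
proof -
  have "A = (SIGMA a:U. cols a)" using sub by (auto simp: cols_def)
  then have "card A = (\<Sum>a\<in>U. card (cols a))" using card_SigmaI[OF finU, of cols] by simp
  also have "\<dots> \<le> (\<Sum>a\<in>U. 12 * (card (cols a) div 12) + 11)"
    by (intro sum_mono) presburger
  also have "\<dots> = 12 * card chunks + 11 * card U"
    by (simp add: chunks_def sum.distrib sum_distrib_left finU)
  finally show ?thesis .
qed

text \<open>\<open>B\<close> keeps the first column of every good chunk. Two kept columns of a
  letter start different chunks, so the chunk starting at the left one ends before the right one,
  and the pair it encloses is strictly nested. At most \<open>M\<close> chunks are bad.\<close>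

lemma thinning:
  obtains B where "B \<subseteq> A" "card A \<le> 12 * (card B + M + card U)"
    "\<And>a p q. (a, p) \<in> B \<Longrightarrow> (a, q) \<in> B \<Longrightarrow> p < q \<Longrightarrow>
       \<exists>b p' q'. d a < d b \<and> (b, p') \<in> A \<and> (b, q') \<in> A \<and> p < p' \<and> p' < q' \<and> q' < q"
proof -
  define G where "G = chunks - bad"
  define f where "f c = (fst c, col (fst c) (12 * snd c))" for c
  have "inj_on f G"
    using chunk_index[where i = 0]
    by (intro inj_onI) (auto simp: f_def G_def col_eq_iff)
  then have cf: "card (f ` G) = card G" by (rule card_image)
  have "card chunks \<le> card G + card bad"
    by (simp add: G_def card_Diff_subset bad_def)
  then have "card chunks \<le> card (f ` G) + M" using card_bad cf by simp
  with card_incidence have "card A \<le> 12 * (card (f ` G) + M + card U)" by simp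
  moreover have "f ` G \<subseteq> A"
    using chunk_index[where i = 0] col_in by (fastforce simp: f_def G_def)
  moreover have "\<exists>b p' q'. d a < d b \<and> (b, p') \<in> A \<and> (b, q') \<in> A \<and> p < p' \<and> p' < q' \<and> q' < q"
    if pq: "(a, p) \<in> f ` G" "(a, q) \<in> f ` G" "p < q" for a p q
  proof -
    have G: "\<exists>j. (a, j) \<in> chunks \<and> good (a, j) \<and> r = col a (12 * j)" if r: "(a, r) \<in> f ` G" for r
      using r by (fastforce simp: f_def G_def bad_def)
    obtain j i where j: "(a, j) \<in> chunks" "good (a, j)" "p = col a (12 * j)"
      and i: "(a, i) \<in> chunks" "q = col a (12 * i)"
      using G[OF pq(1)] G[OF pq(2)] by blast
    have "12 * j < 12 * i"
      using pq(3) chunk_index[OF j(1), of 0] chunk_index[OF i(1), of 0] j i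
      by (simp add: col_less_iff)
    then have "col a (12 * j + 11) < q"
      using chunk_index[OF i(1), of 0] i by (auto intro!: col_less)
    with good_chunk_pair[OF j(1,2)] j(3) show ?thesis
      by (metis le_less_trans)
  qed
  ultimately show thesis using that by blast
qed

end

text \<open>
  The chain is built from the outermost pair inwards: the pair with largest index found in the
  thinned incidence encloses a pair of some letter with a larger value of \<open>d\<close>, which is therefore new.
\<close>

lemma nested_pairs:
  assumes "finite U" "A \<subseteq> U \<times> {..<M}" "inj_on d U" "card A > 24 ^ l * (card U + M)"
  shows "\<exists>a p q. (\<forall>i\<le>l. (a i, p i) \<in> A \<and> (a i, q i) \<in> A \<and> p i < q i) \<and>
     (\<forall>j\<le>l. \<forall>i<j. (p i :: nat) < p j \<and> q j < q i \<and> d (a i) < (d (a j) :: nat))"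
  using assms
proof (induction l arbitrary: A)
  case 0
  have finA: "finite A" using finite_subset[OF "0.prems"(2)] "0.prems"(1) by simp
  have "\<not> inj_on fst A"
  proof
    assume "inj_on fst A"
    then have "card A \<le> card U" using "0.prems" by (intro card_inj_on_le[of fst]) auto
    then show False using "0.prems" by simp
  qed
  then obtain a p q where "(a, p) \<in> A" "(a, q) \<in> A" "p < q"
    unfolding inj_on_def by (metis prod.collapse linorder_neqE_nat)
  then show ?case
    by (intro exI[of _ "\<lambda>_. a"] exI[of _ "\<lambda>_. p"] exI[of _ "\<lambda>_. q"]) auto
next
  case (Suc l)
  interpret ordered_incidence A U M d by standard (use Suc.prems in auto)
  obtain B where B: "B \<subseteq> A" "card A \<le> 12 * (card B + M + card U)"
    "\<And>a p q. (a, p) \<in> B \<Longrightarrow> (a, q) \<in> B \<Longrightarrow> p < q \<Longrightarrow>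
       \<exists>b p' q'. d a < d b \<and> (b, p') \<in> A \<and> (b, q') \<in> A \<and> p < p' \<and> p' < q' \<and> q' < q"
    using thinning by blast
  define T where "T = card U + M"
  \<comment> \<open>Of the factor 24, 12 pays for the thinning and 2 for the additive term
    \<open>T\<close>, which is at most \<open>24 ^ l * T\<close>.\<close>
  have "12 * (24 ^ l * T + 24 ^ l * T) < 12 * (card B + T)"
    using Suc.prems(4) B(2) by (simp add: T_def algebra_simps)
  then have "24 ^ l * T + 24 ^ l * T < card B + T" by (simp only: mult_less_cancel1)
  moreover have "T \<le> 24 ^ l * T" by simp
  ultimately have "24 ^ l * T < card B" by (metis add_le_less_mono add.commute not_le leD add_le_mono)
  then obtain a p q where apq: "\<forall>i\<le>l. (a i, p i) \<in> B \<and> (a i, q i) \<in> B \<and> p i < q i"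
     "\<forall>j\<le>l. \<forall>i<j. p i < p j \<and> q j < q i \<and> d (a i) < d (a j)"
    using Suc.IH[OF Suc.prems(1) subset_trans[OF B(1) Suc.prems(2)] Suc.prems(3)]
    unfolding T_def by blast
  obtain b p' q' where b: "d (a l) < d b" "(b, p') \<in> A" "(b, q') \<in> A" "p l < p'" "p' < q'" "q' < q l"
    using B(3)[of "a l" "p l" "q l"] apq(1) by auto
  have lt: "p i < p' \<and> q' < q i \<and> d (a i) < d b" if "i \<le> l" for i
    using apq(2)[rule_format, of l i] that b by (cases "i = l") auto
  show ?case
    by (intro exI[of _ "a(Suc l := b)"] exI[of _ "p(Suc l := p')"] exI[of _ "q(Suc l := q')"])
       (use apq b lt B(1) in \<open>auto simp: le_Suc_eq less_Suc_eq_le\<close>)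
qed

subsection \<open>Curves to the right of a vertical line\<close>

lemma card_le_image_fibers:
  assumes "finite S" "f ` S \<subseteq> T" "finite T" "\<And>t. t \<in> T \<Longrightarrow> card {x \<in> S. f x = t} \<le> q"
  shows "card S \<le> card T * q"
proof -
  have "card S = (\<Sum>t\<in>T. card {x \<in> S. f x = t})"
    using sum.group[OF assms(1,3,2), of "\<lambda>_. 1 :: nat"] by simp
  also have "\<dots> \<le> (\<Sum>t\<in>T. q)" by (intro sum_mono assms(4))
  finally show ?thesis by simp
qed

text \<open>Mirsky's theorem: the height of \<open>x\<close> is the size of the largest chain
  strictly below \<open>x\<close>. Adding \<open>x\<close> to it gives a chain of size at most
  \<open>h\<close>, and one lying below \<open>y\<close> if \<open>R x y\<close>.\<close>

lemma strict_order_height: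
  fixes R :: "'a \<Rightarrow> 'a \<Rightarrow> bool"
  assumes fin: "finite S"
    and irrefl: "\<And>x. x \<in> S \<Longrightarrow> \<not> R x x"
    and trans: "\<And>x y z. x \<in> S \<Longrightarrow> y \<in> S \<Longrightarrow> z \<in> S \<Longrightarrow> R x y \<Longrightarrow> R y z \<Longrightarrow> R x z"
    and chain: "\<And>C. C \<subseteq> S \<Longrightarrow> pairwise (\<lambda>x y. R x y \<or> R y x) C \<Longrightarrow> card C \<le> h"
  obtains ht :: "'a \<Rightarrow> nat"
  where "\<And>x. x \<in> S \<Longrightarrow> ht x < h" "\<And>x y. x \<in> S \<Longrightarrow> y \<in> S \<Longrightarrow> R x y \<Longrightarrow> ht x < ht y"
proof -
  define down where
    "down x = {C. C \<subseteq> S \<and> pairwise (\<lambda>x y. R x y \<or> R y x) C \<and> (\<forall>c\<in>C. R c x)}" for x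
  define ht where "ht x = Max (card ` down x)" for x
  have fin_down: "finite (down x)" for x
    by (rule finite_subset[of _ "Pow S"]) (use fin in \<open>auto simp: down_def\<close>)
  have ne: "{} \<in> down x" for x by (simp add: down_def)
  have ht_in: "\<exists>C\<in>down x. card C = ht x" for x
  proof -
    have "Max (card ` down x) \<in> card ` down x"
      using fin_down ne[of x] by (intro Max_in) auto
    then show ?thesis unfolding ht_def by (metis imageE)
  qed
  have ht_ge: "card C \<le> ht x" if "C \<in> down x" for C x
    unfolding ht_def using fin_down that by (intro Max_ge) auto
  have ext: "insert x C \<subseteq> S \<and> pairwise (\<lambda>x y. R x y \<or> R y x) (insert x C) \<and>
      card (insert x C) = Suc (card C)" if "x \<in> S" "C \<in> down x" for x C
  proof -
    have "x \<notin> C" using that irrefl by (auto simp: down_def)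
    moreover have "finite C" using that fin finite_subset by (auto simp: down_def)
    ultimately show ?thesis using that by (auto simp: down_def pairwise_insert)
  qed
  show thesis
  proof (rule that)
    fix x assume "x \<in> S"
    obtain C where "C \<in> down x" "card C = ht x" using ht_in by blast
    then show "ht x < h" using ext[OF \<open>x \<in> S\<close>] chain by (metis Suc_le_eq)
  next
    fix x y assume xy: "x \<in> S" "y \<in> S" "R x y"
    obtain C where C: "C \<in> down x" "card C = ht x" using ht_in by blast
    have "\<forall>c\<in>C. R c y" using C(1) xy trans unfolding down_def by blast
    then have "insert x C \<in> down y" using ext[OF xy(1) C(1)] xy by (auto simp: down_def)
    from ht_ge[OF this] ext[OF xy(1) C(1)] C(2) show "ht x < ht y" by simp
  qed
qed

text \<open>For a largest chain \<open>C\<close>, Mirsky's theorem splits \<open>S\<close> into at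
  most \<open>card C\<close> levels. Each level is an antichain and so has at most \<open>q\<close>
  elements.\<close>

lemma large_chain:
  fixes R :: "'a \<Rightarrow> 'a \<Rightarrow> bool"
  assumes fin: "finite S"
    and irrefl: "\<And>x. x \<in> S \<Longrightarrow> \<not> R x x"
    and trans: "\<And>x y z. x \<in> S \<Longrightarrow> y \<in> S \<Longrightarrow> z \<in> S \<Longrightarrow> R x y \<Longrightarrow> R y z \<Longrightarrow> R x z"
    and anti: "\<And>C. C \<subseteq> S \<Longrightarrow> pairwise (\<lambda>x y. \<not> R x y \<and> \<not> R y x) C \<Longrightarrow> card C \<le> q"
  obtains C where "C \<subseteq> S" "pairwise (\<lambda>x y. R x y \<or> R y x) C" "card S \<le> card C * q"
proof -
  define Ch where "Ch = {C. C \<subseteq> S \<and> pairwise (\<lambda>x y. R x y \<or> R y x) C}"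
  have "finite Ch" by (rule finite_subset[of _ "Pow S"]) (use fin in \<open>auto simp: Ch_def\<close>)
  then have fin_img: "finite (card ` Ch)" by simp
  have "{} \<in> Ch" by (simp add: Ch_def)
  then have "Max (card ` Ch) \<in> card ` Ch" using fin_img by (intro Max_in) auto
  then obtain C where C1: "C \<in> Ch" "card C = Max (card ` Ch)" by (metis imageE)
  then have C: "C \<in> Ch" "\<And>D. D \<in> Ch \<Longrightarrow> card D \<le> card C"
    using Max_ge[OF fin_img] by auto
  obtain ht :: "'a \<Rightarrow> nat" where ht: "\<And>x. x \<in> S \<Longrightarrow> ht x < card C"
    "\<And>x y. x \<in> S \<Longrightarrow> y \<in> S \<Longrightarrow> R x y \<Longrightarrow> ht x < ht y"
    proof (rule strict_order_height[of S R "card C"])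
    show "card D \<le> card C" if "D \<subseteq> S" "pairwise (\<lambda>x y. R x y \<or> R y x) D" for D
      using that C(2) by (simp add: Ch_def)
  qed (use fin irrefl trans in blast)+
  have "card S \<le> card {..<card C} * q"
  proof (rule card_le_image_fibers[OF fin])
    show "card {x \<in> S. ht x = t} \<le> q" for t
      by (rule anti) (use ht(2) in \<open>force simp: pairwise_def\<close>)+
  qed (use ht(1) in auto)
  then show thesis using that C(1) by (auto simp: Ch_def)
qed

text \<open>Elements are appended in order of \<open>h\<close>. Ties are broken arbitrarily, whence
  the weak inequality between values.\<close>

lemma monotone_ranking:
  fixes h :: "'a \<Rightarrow> real"
  assumes "finite S"
  obtains pos where "bij_betw pos S {..<card S}"
    "\<And>x y. x \<in> S \<Longrightarrow> y \<in> S \<Longrightarrow> pos x < pos y \<Longrightarrow> h x \<le> h y"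
proof -
  have "\<exists>pos. bij_betw pos S {..<card S} \<and> (\<forall>x\<in>S. \<forall>y\<in>S. pos x < pos y \<longrightarrow> h x \<le> h y)"
    using assms
  proof (induction S rule: finite_ranking_induct[where f = h])
    case empty
    then show ?case by (simp add: bij_betw_def)
  next
    case (insert x S)
    show ?case
    proof (cases "x \<in> S")
      case True
      then show ?thesis using insert by (simp add: insert_absorb)
    next
      case False
      obtain pos where pos: "bij_betw pos S {..<card S}"
        "\<forall>x\<in>S. \<forall>y\<in>S. pos x < pos y \<longrightarrow> h x \<le> h y" using insert by blast
      have "bij_betw (pos(x := card S)) S {..<card S}"
        using pos(1) False by (subst bij_betw_cong[of _ _ pos]) auto
      then have "bij_betw (pos(x := card S)) (S \<union> {x}) ({..<card S} \<union> {(pos(x := card S)) x})"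
        using False by (intro notIn_Un_bij_betw) auto
      then have "bij_betw (pos(x := card S)) (insert x S) {..<card (insert x S)}"
        using False insert(1) by (simp add: lessThan_Suc)
      moreover have "h u \<le> h v" if uv: "u \<in> insert x S" "v \<in> insert x S"
        "(pos(x := card S)) u < (pos(x := card S)) v" for u v
      proof -
        have lt: "pos y < card S" if "y \<in> S" for y
          using pos(1) that by (auto simp: bij_betw_def)
        have "u \<noteq> x" using uv(2,3) lt by (auto split: if_splits dest: less_asym)
        with uv(1) have "u \<in> S" by simp
        with uv pos(2) insert(2) False show ?thesis by (cases "v = x") (auto split: if_splits)
      qed
      ultimately show ?thesis by blast
    qed
  qed
  then show thesis using that by blast
qed

section \<open>Function graphs over intervals with a common left end, and their crossings\<close>

locale right_curves =
  fixes E :: "'e set" and X :: real and r :: "'e \<Rightarrow> real" and y :: "'e \<Rightarrow> real \<Rightarrow> real"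
    and q :: nat
  assumes fin: "finite E"
    and X_less: "\<And>e. e \<in> E \<Longrightarrow> X < r e"
    and cont: "\<And>e. e \<in> E \<Longrightarrow> continuous_on {X..r e} (y e)"
    and avoid: "\<And>e f. e \<in> E \<Longrightarrow> f \<in> E \<Longrightarrow> r e < r f \<Longrightarrow> y f (r e) \<noteq> y e (r e)"
    and clique: "\<And>F. F \<subseteq> E \<Longrightarrow>
      pairwise (\<lambda>e f. \<exists>x. X \<le> x \<and> x < r e \<and> x < r f \<and> y e x = y f x) F \<Longrightarrow> card F \<le> q"
begin

text \<open>The abscissa \<open>X\<close> is included and the right ends are excluded: non-crossing
  curves have different heights at \<open>X\<close>, while a common right end is no
  crossing.\<close>

definition cross :: "'e \<Rightarrow> 'e \<Rightarrow> bool" where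
  "cross e f \<longleftrightarrow> (\<exists>x. X \<le> x \<and> x < r e \<and> x < r f \<and> y e x = y f x)"

definition vertex :: "'e \<Rightarrow> real \<times> real" where "vertex e = (r e, y e (r e))"

lemma clique_cross: "F \<subseteq> E \<Longrightarrow> pairwise cross F \<Longrightarrow> card F \<le> q"
  using clique by (simp add: cross_def[abs_def])

lemma cross_sym: "cross e f \<Longrightarrow> cross f e"
  unfolding cross_def by metis

text \<open>By the intermediate value theorem, a reversed order at \<open>x\<close> would give a
  common point strictly before \<open>x\<close>, hence a crossing. Here \<open>x\<close> itself may
  be a right end.\<close>

lemma stays_le:
  assumes "e \<in> E" "f \<in> E" "\<not> cross e f" "y e X \<le> y f X" "X \<le> x" "x \<le> r e" "x \<le> r f"
  shows "y e x \<le> y f x"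
proof (rule ccontr)
  assume "\<not> y e x \<le> y f x"
  then have "y f x - y e x \<le> 0" "0 \<le> y f X - y e X" using assms by auto
  moreover have "continuous_on {X..x} (\<lambda>t. y f t - y e t)"
    by (intro continuous_on_diff continuous_on_subset[OF cont]) (use assms in auto)
  ultimately obtain z where "X \<le> z" "z \<le> x" "y f z - y e z = 0"
    using IVT2'[of "\<lambda>t. y f t - y e t" x 0 X] \<open>X \<le> x\<close> by auto
  with \<open>\<not> y e x \<le> y f x\<close> have "z < x" "y e z = y f z" by (auto simp: less_le)
  with \<open>X \<le> z\<close> assms(3,6,7) show False unfolding cross_def by force
qed

lemma stays_less:
  assumes "e \<in> E" "f \<in> E" "\<not> cross e f" "y e X \<le> y f X" "X \<le> x" "x < r e" "x < r f"
  shows "y e x < y f x"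
  using stays_le[OF assms(1-5)] assms by (force simp: cross_def)

text \<open>Non-crossing says nothing at the end of the shorter curve; there \<open>avoid\<close>
  supplies the strictness.\<close>

lemma end_less:
  assumes "e \<in> E" "f \<in> E" "\<not> cross e f" "y e X \<le> y f X" "r e < r f"
  shows "y e (r e) < y f (r e)"
  using stays_le[OF assms(1-4), of "r e"] avoid[OF assms(1,2,5)] X_less[OF assms(1)] assms(5) by auto

lemma end_greater:
  assumes "e \<in> E" "f \<in> E" "\<not> cross e f" "y e X \<le> y f X" "r f < r e"
  shows "y e (r f) < y f (r f)"
  using stays_le[OF assms(1-4), of "r f"] avoid[OF assms(2,1,5)] X_less[OF assms(2)] assms(5) by auto

lemma end_le:
  assumes "e \<in> E" "f \<in> E" "\<not> cross e f" "y e X \<le> y f X" "r e = r f"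
  shows "y e (r e) \<le> y f (r f)"
  using stays_le[OF assms(1-4), of "r e"] X_less[OF assms(1)] assms(5) by auto

lemma not_crossI:
  assumes "\<And>x. X \<le> x \<Longrightarrow> x < r e \<Longrightarrow> x < r f \<Longrightarrow> y e x < y f x"
  shows "\<not> cross e f"
  using assms by (force simp: cross_def)

lemma right_curves_subset:
  assumes "F \<subseteq> E"
  shows "right_curves F X r y q"
proof
  show "finite F" using assms fin finite_subset by blast
  show "X < r e" "continuous_on {X..r e} (y e)" if "e \<in> F" for e
    using that assms X_less cont by blast+
  show "y f (r e) \<noteq> y e (r e)" if "e \<in> F" "f \<in> F" "r e < r f" for e f
    using that assms avoid by blast
qed (use assms clique in blast)

text \<open>Among curves with a common right end, \<open>R\<close> (lying below before the end) is a
  strict order, and incomparable curves cross. Antichains thus have at most \<open>q\<close>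
  members, and a large chain can be kept at each end.\<close>

lemma thin_vertices:
  obtains F where "F \<subseteq> E" "card E \<le> card F * q"
    "\<And>e f. e \<in> F \<Longrightarrow> f \<in> F \<Longrightarrow> e \<noteq> f \<Longrightarrow> vertex e = vertex f \<Longrightarrow> \<not> cross e f"
proof -
  define R where "R e f \<longleftrightarrow> (\<forall>x. X \<le> x \<and> x < r e \<longrightarrow> y e x < y f x)" for e f
  define S where "S w = {e \<in> E. vertex e = w}" for w
  have "\<exists>C. C \<subseteq> S w \<and> pairwise (\<lambda>e f. R e f \<or> R f e) C \<and> card (S w) \<le> card C * q" for w
  proof -
    have r_eq: "r e = r f" if "e \<in> S w" "f \<in> S w" for e f
      using that by (auto simp: S_def vertex_def)
    have fS: "finite (S w)" using fin by (simp add: S_def)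
    have irr: "\<not> R e e" if "e \<in> S w" for e using X_less that by (auto simp: R_def S_def)
    have tr: "R e g" if "e \<in> S w" "f \<in> S w" "g \<in> S w" "R e f" "R f g" for e f g
      using that r_eq[OF that(1,2)] unfolding R_def by fastforce
    have anti: "card C \<le> q" if C: "C \<subseteq> S w" "pairwise (\<lambda>e f. \<not> R e f \<and> \<not> R f e) C" for C
    proof (rule clique_cross)
      show "C \<subseteq> E" using C by (auto simp: S_def)
      show "pairwise cross C"
      proof (rule pairwiseI)
        fix e f assume ef: "e \<in> C" "f \<in> C" "e \<noteq> f"
        have E: "e \<in> E" "f \<in> E" using ef C by (auto simp: S_def)
        have nR: "\<not> R e f" "\<not> R f e" using C(2) ef by (auto simp: pairwise_def)
        have rr: "r e = r f" using r_eq ef C by blast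
        show "cross e f"
        proof (rule ccontr)
          assume nc: "\<not> cross e f"
          then have nc': "\<not> cross f e" using cross_sym by blast
          show False
            using stays_less[OF E nc] stays_less[OF E(2,1) nc'] nR rr unfolding R_def
            by (metis linear)
        qed
      qed
    qed
    show ?thesis by (rule large_chain[of "S w" R q, OF fS irr tr anti]) auto
  qed
  then obtain C where C: "\<And>w. C w \<subseteq> S w" "\<And>w. pairwise (\<lambda>e f. R e f \<or> R f e) (C w)"
    "\<And>w. card (S w) \<le> card (C w) * q" by metis
  have vx: "vertex g = w" if "g \<in> C w" for g w using C(1) that unfolding S_def by blast
  have CE: "C w \<subseteq> E" for w using C(1) unfolding S_def by blast
  define F where "F = (\<Union>w\<in>vertex ` E. C w)"
  have FE: "F \<subseteq> E" using CE unfolding F_def by blast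
  have "card E = (\<Sum>w\<in>vertex ` E. card (S w))"
    using sum.group[OF fin, of "vertex ` E" vertex "\<lambda>_. 1 :: nat"] fin by (simp add: S_def)
  also have "\<dots> \<le> (\<Sum>w\<in>vertex ` E. card (C w) * q)" by (intro sum_mono C(3))
  also have "\<dots> = (\<Sum>w\<in>vertex ` E. card (C w)) * q" by (simp add: sum_distrib_right)
  also have "(\<Sum>w\<in>vertex ` E. card (C w)) = card F"
    unfolding F_def
  proof (rule card_UN_disjoint[symmetric])
    show "\<forall>w\<in>vertex ` E. finite (C w)"
      using CE fin finite_subset by blast
    show "\<forall>w\<in>vertex ` E. \<forall>w'\<in>vertex ` E. w \<noteq> w' \<longrightarrow> C w \<inter> C w' = {}"
      using vx by (metis disjoint_iff)
  qed (use fin in simp)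
  finally have "card E \<le> card F * q" .
  moreover have "\<not> cross e f" if ef: "e \<in> F" "f \<in> F" "e \<noteq> f" "vertex e = vertex f" for e f
  proof -
    obtain w w' where "e \<in> C w" "f \<in> C w'" using ef(1,2) unfolding F_def by blast
    then have "e \<in> C w" "f \<in> C w" using vx ef(4) by (metis, metis)
    then have "R e f \<or> R f e" using C(2) ef by (auto simp: pairwise_def)
    moreover have "r e = r f" using ef by (simp add: vertex_def)
    ultimately have "\<not> cross e f \<or> \<not> cross f e" unfolding R_def by (metis not_crossI)
    then show ?thesis using cross_sym by blast
  qed
  ultimately show thesis using that FE by blast
qed

text \<open>
  Let \<open>i < j\<close> and suppose that \<open>b i\<close> and \<open>b j\<close> do not cross. If \<open>w i\<close> is not to the right of \<open>w j\<close>,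
  then \<open>b j\<close> passes below \<open>w i\<close>; were \<open>a i\<close>, \<open>a j\<close> disjoint, \<open>a j\<close> would pass above it, although \<open>a j\<close>
  stays below \<open>b j\<close>. Otherwise \<open>b i\<close> passes above \<open>w j\<close>, which forces \<open>c i\<close> and \<open>c j\<close> to cross.
  Both kinds of non-crossing pairs of \<open>b\<close>'s form strict partial orders, with chains of length at
  most \<open>q\<close>, and sets avoiding both kinds are pairwise crossing.
\<close>

lemma up_down_up_bound:
  fixes a b c :: "nat \<Rightarrow> 'e"
  assumes E: "\<And>i. i < l \<Longrightarrow> a i \<in> E \<and> b i \<in> E \<and> c i \<in> E"
    and vx: "\<And>i. i < l \<Longrightarrow> vertex (a i) = w i \<and> vertex (b i) = w i \<and> vertex (c i) = w i"
    and nc: "\<And>i. i < l \<Longrightarrow> \<not> cross (a i) (b i) \<and> \<not> cross (b i) (c i)"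
    and ht: "\<And>i. i < l \<Longrightarrow> y (a i) X \<le> y (b i) X \<and> y (b i) X \<le> y (c i) X"
    and w: "\<And>i j. i < j \<Longrightarrow> j < l \<Longrightarrow> w i \<noteq> w j"
    and mono: "\<And>i j. i < j \<Longrightarrow> j < l \<Longrightarrow>
      y (a i) X \<le> y (a j) X \<and> y (b j) X \<le> y (b i) X \<and> y (c i) X \<le> y (c j) X"
  shows "l \<le> q ^ 3"
proof -
  define x where "x i = fst (w i)" for i
  define z where "z i = snd (w i)" for i
  have rx: "r (a i) = x i \<and> r (b i) = x i \<and> r (c i) = x i" if "i < l" for i
    using vx[OF that] by (metis x_def vertex_def fst_conv)
  have yz: "y (a i) (x i) = z i \<and> y (b i) (x i) = z i \<and> y (c i) (x i) = z i" if "i < l" for i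
    using vx[OF that] rx[OF that] by (metis z_def vertex_def snd_conv)
  have Xx: "X < x i" if "i < l" for i using X_less[of "a i"] E[OF that] rx[OF that] by simp
  have wne: "x i \<noteq> x j \<or> z i \<noteq> z j" if "i < j" "j < l" for i j
    using w[OF that] by (simp add: x_def z_def prod_eq_iff)
  have inj: "inj_on g {..<l}" if "\<And>i. i < l \<Longrightarrow> vertex (g i) = w i" for g
    using w that by (intro inj_onI) (metis lessThan_iff linorder_neqE_nat)
  have clique': "card C \<le> q"
    if C: "C \<subseteq> {..<l}" "\<And>i. i < l \<Longrightarrow> g i \<in> E" "\<And>i. i < l \<Longrightarrow> vertex (g i) = w i"
      "\<And>i j. i \<in> C \<Longrightarrow> j \<in> C \<Longrightarrow> i < j \<Longrightarrow> cross (g i) (g j)" for C g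
  proof -
    have "card (g ` C) \<le> q"
    proof (rule clique_cross)
      show "g ` C \<subseteq> E" using C by auto
      show "pairwise cross (g ` C)"
        using C(4) cross_sym by (intro pairwiseI) (metis imageE linorder_neqE_nat)
    qed
    moreover have "card (g ` C) = card C"
      by (rule card_image) (use inj[OF C(3)] C(1) inj_on_subset in blast)
    ultimately show ?thesis by simp
  qed

  \<comment> \<open>The comparison of abscissae makes these relations transitive: the middle curve
    is defined wherever both outer ones are.\<close>
  define P where "P i j \<longleftrightarrow> i < j \<and> x i \<le> x j \<and> \<not> cross (b j) (b i)" for i j
  define Q where "Q i j \<longleftrightarrow> i < j \<and> x j < x i \<and> \<not> cross (b j) (b i)" for i j
  have b_less: "y (b j) t < y (b i) t"
    if "i < j" "j < l" "\<not> cross (b j) (b i)" "X \<le> t" "t < x i" "t < x j" for i j t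
    using stays_less[of "b j" "b i" t] that E[of i] E[of j] rx[of i] rx[of j] mono[of i j] by auto
  have P_a: "cross (a i) (a j)" if P: "P i j" "j < l" for i j
  proof (rule ccontr)
    assume nca: "\<not> cross (a i) (a j)"
    have ij: "i < j" "i < l" "j < l" "x i \<le> x j" "\<not> cross (b j) (b i)" using P by (auto simp: P_def)
    note EE = E[OF ij(2)] E[OF ij(3)] and RR = rx[OF ij(2)] rx[OF ij(3)]
      and YY = yz[OF ij(2)] yz[OF ij(3)] and MM = mono[OF ij(1,3)]
    show False
    proof (cases "x i = x j")
      \<comment> \<open>At equal abscissae the \<open>a\<close>'s give \<open>z i \<le> z j\<close>
        and the \<open>b\<close>'s the reverse, so the vertices would coincide.\<close>
      case True
      then have "z i \<le> z j" "z j \<le> z i"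
        using end_le[of "a i" "a j"] end_le[of "b j" "b i"] EE RR YY MM nca ij by auto
      with wne[OF ij(1,3)] True show False by simp
    next
      case False
      then have "x i < x j" using ij by simp
      then have "z i < y (a j) (x i)" "y (b j) (x i) < z i"
        using end_less[of "a i" "a j"] end_greater[of "b j" "b i"] EE RR YY MM nca ij by auto
      moreover have "y (a j) (x i) < y (b j) (x i)"
        using stays_less[of "a j" "b j" "x i"] EE RR nc[OF ij(3)] ht[OF ij(3)] Xx[OF ij(2)]
          \<open>x i < x j\<close> by auto
      ultimately show False by simp
    qed
  qed
  have Q_c: "cross (c i) (c j)" if Q: "Q i j" "j < l" for i j
  proof (rule ccontr)
    assume ncc: "\<not> cross (c i) (c j)"
    have ij: "i < j" "i < l" "j < l" "x j < x i" "\<not> cross (b j) (b i)" using Q by (auto simp: Q_def)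
    note EE = E[OF ij(2)] E[OF ij(3)] and RR = rx[OF ij(2)] rx[OF ij(3)]
      and YY = yz[OF ij(2)] yz[OF ij(3)] and MM = mono[OF ij(1,3)]
    have "z j < y (b i) (x j)" "y (c i) (x j) < z j"
      using end_less[of "b j" "b i"] end_greater[of "c i" "c j"] EE RR YY MM ncc ij by auto
    moreover have "y (b i) (x j) < y (c i) (x j)"
      using stays_less[of "b i" "c i" "x j"] EE RR nc[OF ij(2)] ht[OF ij(2)] Xx[OF ij(3)] ij by auto
    ultimately show False by simp
  qed
  have P_trans: "P i m" if "P i j" "P j m" "m < l" for i j m
  proof -
    have "\<not> cross (b m) (b i)"
    proof (rule not_crossI)
      fix t assume t: "X \<le> t" "t < r (b m)" "t < r (b i)"
      have "y (b m) t < y (b j) t" "y (b j) t < y (b i) t"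
        using b_less[of j m t] b_less[of i j t] that t rx[of i] rx[of m] by (auto simp: P_def)
      then show "y (b m) t < y (b i) t" by simp
    qed
    with that show ?thesis by (auto simp: P_def)
  qed
  have Q_trans: "Q i m" if "Q i j" "Q j m" "m < l" for i j m
  proof -
    have "\<not> cross (b m) (b i)"
    proof (rule not_crossI)
      fix t assume t: "X \<le> t" "t < r (b m)" "t < r (b i)"
      have "y (b m) t < y (b j) t" "y (b j) t < y (b i) t"
        using b_less[of j m t] b_less[of i j t] that t rx[of i] rx[of m] by (auto simp: Q_def)
      then show "y (b m) t < y (b i) t" by simp
    qed
    with that show ?thesis by (auto simp: Q_def)
  qed
  obtain h1 :: "nat \<Rightarrow> nat" where h1: "\<And>i. i \<in> {..<l} \<Longrightarrow> h1 i < q"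
    "\<And>i j. i \<in> {..<l} \<Longrightarrow> j \<in> {..<l} \<Longrightarrow> P i j \<Longrightarrow> h1 i < h1 j"
  proof (rule strict_order_height[of "{..<l}" P q])
    show "card C \<le> q" if C: "C \<subseteq> {..<l}" "pairwise (\<lambda>i j. P i j \<or> P j i) C" for C
    proof (rule clique'[of C a])
      fix i j assume "i \<in> C" "j \<in> C" "i < j"
      then have "P i j" using C(2) by (fastforce simp: pairwise_def P_def)
      then show "cross (a i) (a j)" using P_a C(1) \<open>j \<in> C\<close> by blast
    qed (use C E vx in auto)
  qed (use P_trans in \<open>auto simp: P_def[of i i for i]\<close>)
  obtain h2 :: "nat \<Rightarrow> nat" where h2: "\<And>i. i \<in> {..<l} \<Longrightarrow> h2 i < q"
    "\<And>i j. i \<in> {..<l} \<Longrightarrow> j \<in> {..<l} \<Longrightarrow> Q i j \<Longrightarrow> h2 i < h2 j"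
  proof (rule strict_order_height[of "{..<l}" Q q])
    show "card C \<le> q" if C: "C \<subseteq> {..<l}" "pairwise (\<lambda>i j. Q i j \<or> Q j i) C" for C
    proof (rule clique'[of C c])
      fix i j assume "i \<in> C" "j \<in> C" "i < j"
      then have "Q i j" using C(2) by (fastforce simp: pairwise_def Q_def)
      then show "cross (c i) (c j)" using Q_c C(1) \<open>j \<in> C\<close> by blast
    qed (use C E vx in auto)
  qed (use Q_trans in \<open>auto simp: Q_def[of i i for i]\<close>)
  \<comment> \<open>A fibre of \<open>(h1, h2)\<close> contains no pair related by \<open>P\<close>
    or \<open>Q\<close>, so its \<open>b\<close>'s cross pairwise; there are at most
    \<open>q * q\<close> fibres.\<close>
  have "card {..<l} \<le> card ({..<q} \<times> {..<q}) * q"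
  proof (rule card_le_image_fibers[of _ "\<lambda>i. (h1 i, h2 i)"])
    show "card {i \<in> {..<l}. (h1 i, h2 i) = t} \<le> q" for t
    proof (rule clique'[of _ b])
      fix i j
      assume ij: "i \<in> {i \<in> {..<l}. (h1 i, h2 i) = t}" "j \<in> {i \<in> {..<l}. (h1 i, h2 i) = t}" "i < j"
      then have "\<not> P i j" "\<not> Q i j" using h1(2)[of i j] h2(2)[of i j] by auto
      then have "cross (b j) (b i)" using ij(3) by (auto simp: P_def Q_def)
      then show "cross (b i) (b j)" by (rule cross_sym)
    qed (use E vx in auto)
  qed (use h1(1) h2(1) in auto)
  then show ?thesis by (simp add: power3_eq_cube card_cartesian_product)
qed

text \<open>
  Letters are endpoints, columns are blocks of consecutive edges along the line, and \<open>d\<close> is the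
  position of the last edge at an endpoint. A nested chain gives the first two runs of an up-down-up
  pattern; the last edges at the same endpoints supply the third.
\<close>

lemma card_vertex_blocks:
  assumes thin: "\<And>e f. e \<in> E \<Longrightarrow> f \<in> E \<Longrightarrow> e \<noteq> f \<Longrightarrow> vertex e = vertex f \<Longrightarrow> \<not> cross e f"
    and pos: "inj_on pos E" "\<And>e f. e \<in> E \<Longrightarrow> f \<in> E \<Longrightarrow> pos e < pos f \<Longrightarrow> y e X \<le> y f X"
    and blocks: "\<And>e. e \<in> E \<Longrightarrow> pos e div K < M"
  shows "card ((\<lambda>e. (vertex e, pos e div K)) ` E) \<le> 2 * 24 ^ (q ^ 3) * (card (vertex ` E) + M)"
proof -
  define A where "A = (\<lambda>e. (vertex e, pos e div K)) ` E"
  define S where "S w = {e \<in> E. vertex e = w}" for w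
  define d where "d w = Max (pos ` S w)" for w
  \<comment> \<open>Without the block of the last edge at \<open>w\<close>, that edge comes after
    every edge counted in \<open>B\<close> at \<open>w\<close> and can serve as the third edge
    \<open>c\<close>.\<close>
  define B where "B = {(w, c) \<in> A. c < d w div K}"
  have finS: "finite (S w)" for w using fin by (simp add: S_def)
  have d_in: "\<exists>e\<in>E. vertex e = w \<and> pos e = d w" if "w \<in> vertex ` E" for w
  proof -
    have "pos ` S w \<noteq> {}" using that by (auto simp: S_def)
    then have "d w \<in> pos ` S w" unfolding d_def using finS by (intro Max_in) auto
    then show ?thesis by (auto simp: S_def)
  qed
  have d_ge: "pos e \<le> d (vertex e)" if "e \<in> E" for e
    unfolding d_def by (rule Max_ge) (use that finS in \<open>auto simp: S_def\<close>)
  have inj_d: "inj_on d (vertex ` E)"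
  proof (rule inj_onI)
    fix w w' assume "w \<in> vertex ` E" "w' \<in> vertex ` E" "d w = d w'"
    then show "w = w'" using d_in[of w] d_in[of w'] pos(1) by (metis inj_onD)
  qed
  have BA: "B \<subseteq> vertex ` E \<times> {..<M}" using blocks by (auto simp: B_def A_def)
  have cB: "card B \<le> 24 ^ (q ^ 3) * (card (vertex ` E) + M)"
  proof (rule ccontr)
    assume "\<not> card B \<le> 24 ^ (q ^ 3) * (card (vertex ` E) + M)"
    then obtain w s t where wst: "\<forall>i\<le>q ^ 3. (w i, s i) \<in> B \<and> (w i, t i) \<in> B \<and> s i < t i"
       "\<forall>j\<le>q ^ 3. \<forall>i<j. s i < s j \<and> t j < t i \<and> d (w i) < d (w j)"
      using nested_pairs[OF _ BA inj_d, of "q ^ 3"] fin by (auto simp: not_le)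
    have "\<exists>e\<in>E. vertex e = w i \<and> pos e div K = s i" if "i \<le> q ^ 3" for i
      using wst(1) that by (fastforce simp: B_def A_def)
    then obtain a where a: "\<And>i. i \<le> q ^ 3 \<Longrightarrow> a i \<in> E \<and> vertex (a i) = w i \<and> pos (a i) div K = s i"
      by metis
    have "\<exists>e\<in>E. vertex e = w i \<and> pos e div K = t i" if "i \<le> q ^ 3" for i
      using wst(1) that by (fastforce simp: B_def A_def)
    then obtain b where b: "\<And>i. i \<le> q ^ 3 \<Longrightarrow> b i \<in> E \<and> vertex (b i) = w i \<and> pos (b i) div K = t i"
      by metis
    have "\<exists>e\<in>E. vertex e = w i \<and> pos e = d (w i)" if "i \<le> q ^ 3" for i
      using a[OF that] d_in[of "w i"] by (metis imageI)
    then obtain c where c: "\<And>i. i \<le> q ^ 3 \<Longrightarrow> c i \<in> E \<and> vertex (c i) = w i \<and> pos (c i) = d (w i)"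
      by metis
    have div_less: "m < n" if "m div K < n div K" for m n
      using that div_le_mono[of n m K] by (meson not_le)
    have ab: "pos (a i) < pos (b i)" if i: "i \<le> q ^ 3" for i
    proof (rule div_less)
      show "pos (a i) div K < pos (b i) div K" using a[OF i] b[OF i] wst(1)[rule_format, OF i] by simp
    qed
    have bc: "pos (b i) < pos (c i)" if i: "i \<le> q ^ 3" for i
    proof (rule div_less)
      have "t i < d (w i) div K" using wst(1)[rule_format, OF i] by (simp add: B_def)
      then show "pos (b i) div K < pos (c i) div K" using b[OF i] c[OF i] by simp
    qed
    \<comment> \<open>The chain is indexed from \<open>0\<close> to \<open>q ^ 3\<close>, one more
      pair than the pattern bound allows.\<close>
    have "Suc (q ^ 3) \<le> q ^ 3"
    proof (rule up_down_up_bound[where a = a and b = b and c = c and w = w])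
      fix i assume "i < Suc (q ^ 3)"
      then have i: "i \<le> q ^ 3" by simp
      show "a i \<in> E \<and> b i \<in> E \<and> c i \<in> E" using a b c i by simp
      show "vertex (a i) = w i \<and> vertex (b i) = w i \<and> vertex (c i) = w i" using a b c i by simp
      have "a i \<noteq> b i" "b i \<noteq> c i" using ab[OF i] bc[OF i] by auto
      then show "\<not> cross (a i) (b i) \<and> \<not> cross (b i) (c i)"
        using thin a[OF i] b[OF i] c[OF i] by simp
      show "y (a i) X \<le> y (b i) X \<and> y (b i) X \<le> y (c i) X"
        using pos(2) ab[OF i] bc[OF i] a[OF i] b[OF i] c[OF i] by simp
    next
      fix i j assume ij: "i < j" "j < Suc (q ^ 3)"
      then have le: "i \<le> q ^ 3" "j \<le> q ^ 3" by auto
      have wj: "s i < s j" "t j < t i" "d (w i) < d (w j)" using wst(2) ij(1) le(2) by auto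
      then show "w i \<noteq> w j" by auto
      have "pos (a i) < pos (a j)" "pos (b j) < pos (b i)"
        using wj a[OF le(1)] a[OF le(2)] b[OF le(1)] b[OF le(2)] by (auto intro: div_less)
      then show "y (a i) X \<le> y (a j) X \<and> y (b j) X \<le> y (b i) X \<and> y (c i) X \<le> y (c j) X"
        using pos(2) wj a[OF le(1)] a[OF le(2)] b[OF le(1)] b[OF le(2)] c[OF le(1)] c[OF le(2)] by simp
    qed
    then show False by simp
  qed
  \<comment> \<open>Each vertex loses only its last block in passing to \<open>B\<close>; this
    accounts for the factor 2.\<close>
  have "A \<subseteq> B \<union> (\<lambda>w. (w, d w div K)) ` vertex ` E"
    using d_ge div_le_mono by (fastforce simp: A_def B_def not_less dest: le_antisym)
  then have "card A \<le> card (B \<union> (\<lambda>w. (w, d w div K)) ` vertex ` E)"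
    using fin finite_subset[OF BA] by (intro card_mono) auto
  also have "\<dots> \<le> card B + card ((\<lambda>w. (w, d w div K)) ` vertex ` E)" by (rule card_Un_le)
  also have "card ((\<lambda>w. (w, d w div K)) ` vertex ` E) \<le> card (vertex ` E)"
    using fin by (intro card_image_le) simp
  also have "card (vertex ` E) \<le> 24 ^ (q ^ 3) * (card (vertex ` E) + M)"
    by (metis le_add1 mult_le_mono nat_mult_1 one_le_numeral one_le_power)
  finally show ?thesis using cB unfolding A_def by (simp add: mult.assoc)
qed

end

subsection \<open>Edges crossing a vertical line\<close>

text \<open>Two sets with fewer than \<open>Q\<close> elements form fewer than \<open>Q * Q\<close>
  pairs. The maps will be the right and left ends of the edges in a block.\<close>

lemma card_image_pairs:
  assumes "finite S" "inj_on (\<lambda>e. (f e, g e)) S" "Q * Q \<le> card S"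
  shows "Q \<le> card (f ` S) + card (g ` S)"
proof (rule ccontr)
  assume "\<not> Q \<le> card (f ` S) + card (g ` S)"
  then have *: "card (f ` S) < Q" "card (g ` S) < Q" by auto
  have "card S \<le> card (f ` S \<times> g ` S)"
    by (rule card_inj_on_le[OF assms(2)]) (use assms(1) in auto)
  also have "\<dots> < Q * Q" using * by (simp add: card_cartesian_product mult_strict_mono)
  finally show False using assms(3) by simp
qed

text \<open>The left parts of the edges enter reflected, so that they too run to the right of a line.\<close>

locale crossing_line =
  right: right_curves E X r y q + left: right_curves E X' r' y' q
  for E :: "'e set" and X r y q X' r' y' +
  assumes same_height: "\<And>e. e \<in> E \<Longrightarrow> y' e X' = y e X"
    and ends: "inj_on (\<lambda>e. (right.vertex e, left.vertex e)) E"
begin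

lemma crossing_line_subset: "F \<subseteq> E \<Longrightarrow> crossing_line F X r y q X' r' y'"
  using right.right_curves_subset[of F] left.right_curves_subset[of F] same_height ends
  unfolding crossing_line_def crossing_line_axioms_def by (auto intro: inj_on_subset)

text \<open>Double counting of incidences between ends and blocks: each of the \<open>M\<close> full
  blocks has at least \<open>Q\<close> distinct ends on the two sides together, while each side has
  at most \<open>2 * D * (n + (M + 1))\<close> incidences.\<close>

lemma card_thin:
  assumes thin: "\<And>e f. e \<in> E \<Longrightarrow> f \<in> E \<Longrightarrow> e \<noteq> f \<Longrightarrow> right.vertex e = right.vertex f \<Longrightarrow> \<not> right.cross e f"
    "\<And>e f. e \<in> E \<Longrightarrow> f \<in> E \<Longrightarrow> e \<noteq> f \<Longrightarrow> left.vertex e = left.vertex f \<Longrightarrow> \<not> left.cross e f"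
    and n: "card (right.vertex ` E) \<le> n" "card (left.vertex ` E) \<le> n"
  shows "card E \<le> 192 * 24 ^ (2 * q ^ 3) * n"
proof (cases "E = {}")
  case False
  define D :: nat where "D = 24 ^ (q ^ 3)"
  \<comment> \<open>The upper bounds contribute \<open>4 * D * M\<close>; taking
    \<open>8 * D\<close> leaves half of the lower bound \<open>Q * M\<close>, whence
    \<open>M \<le> n + 1\<close>.\<close>
  define Q where "Q = 8 * D"
  define K where "K = Q * Q"
  \<comment> \<open>Only full blocks are counted; a possible incomplete one makes
    \<open>M + 1\<close> columns.\<close>
  define M where "M = card E div K"
  have D: "0 < D" "0 < Q" "0 < K" by (simp_all add: D_def Q_def K_def)
  have "1 \<le> card (right.vertex ` E)"
    using False right.fin by (simp add: Suc_le_eq card_gt_0_iff)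
  then have n1: "1 \<le> n" using n by simp
  obtain pos where pos: "bij_betw pos E {..<card E}"
    "\<And>e f. e \<in> E \<Longrightarrow> f \<in> E \<Longrightarrow> pos e < pos f \<Longrightarrow> y e X \<le> y f X"
    using monotone_ranking[OF right.fin, of "\<lambda>e. y e X"] by blast
  have inj: "inj_on pos E" and img: "pos ` E = {..<card E}" using pos(1) by (auto simp: bij_betw_def)
  have blk: "pos e div K < M + 1" if "e \<in> E" for e
  proof -
    have "pos e < card E" using that img by blast
    then show ?thesis using div_le_mono[of "pos e" "card E" K] by (simp add: M_def)
  qed
  define AR where "AR = (\<lambda>e. (right.vertex e, pos e div K)) ` E"
  define AL where "AL = (\<lambda>e. (left.vertex e, pos e div K)) ` E"
  have cR: "card AR \<le> 2 * D * (n + (M + 1))"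
  proof -
    have "card AR \<le> 2 * D * (card (right.vertex ` E) + (M + 1))"
      unfolding AR_def D_def by (rule right.card_vertex_blocks[OF thin(1) inj pos(2) blk])
    also have "\<dots> \<le> 2 * D * (n + (M + 1))" using n by simp
    finally show ?thesis .
  qed
  have cL: "card AL \<le> 2 * D * (n + (M + 1))"
  proof -
    have "card AL \<le> 2 * D * (card (left.vertex ` E) + (M + 1))"
      unfolding AL_def D_def
      by (rule left.card_vertex_blocks[OF thin(2) inj _ blk]) (use pos(2) same_height in auto)
    also have "\<dots> \<le> 2 * D * (n + (M + 1))" using n by simp
    finally show ?thesis .
  qed
  define S where "S t = {e \<in> E. pos e div K = t}" for t
  have finS: "finite (S t)" for t using right.fin by (simp add: S_def)
  have cS: "K \<le> card (S t)" if "t < M" for t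
  proof -
    have "{t * K..<t * K + K} \<subseteq> pos ` S t"
    proof
      fix p assume p: "p \<in> {t * K..<t * K + K}"
      have "p div K = t" using p D by (intro div_nat_eqI) (auto simp: mult.commute)
      moreover have "t * K + K \<le> M * K" using that by (metis Suc_leI mult_Suc add.commute mult_le_mono1)
      moreover have "M * K \<le> card E" by (simp add: M_def)
      ultimately have "p \<in> {..<card E}" "p div K = t" using p by auto
      then show "p \<in> pos ` S t" using img by (auto simp: S_def)
    qed
    then have "card {t * K..<t * K + K} \<le> card (S t)"
      using finS surj_card_le by blast
    then show ?thesis by simp
  qed
  have sum_le: "(\<Sum>t<M. card (v ` S t)) \<le> card ((\<lambda>e. (v e, pos e div K)) ` E)"
    for v :: "'e \<Rightarrow> real \<times> real"
  proof -
    have "(\<Sum>t<M. card (v ` S t)) = card (SIGMA t:{..<M}. v ` S t)"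
      using finS by (subst card_SigmaI) auto
    also have "\<dots> \<le> card ((\<lambda>e. (v e, pos e div K)) ` E)"
      by (rule card_inj_on_le[of prod.swap])
        (use right.fin in \<open>auto simp: S_def inj_on_def\<close>)
    finally show ?thesis .
  qed
  have "Q * M = (\<Sum>t<M. Q)" by simp
  also have "\<dots> \<le> (\<Sum>t<M. card (right.vertex ` S t) + card (left.vertex ` S t))"
  proof (intro sum_mono card_image_pairs)
    show "inj_on (\<lambda>e. (right.vertex e, left.vertex e)) (S t)" for t
      using ends by (rule inj_on_subset) (auto simp: S_def)
  qed (use cS finS in \<open>auto simp: K_def\<close>)
  also have "\<dots> \<le> card AR + card AL"
    unfolding sum.distrib AR_def AL_def by (intro add_mono sum_le)
  also have "\<dots> \<le> D * (4 * (n + (M + 1)))" using add_mono[OF cR cL] by (simp add: algebra_simps)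
  finally have "D * (8 * M) \<le> D * (4 * (n + (M + 1)))" by (simp add: Q_def mult.assoc mult.left_commute)
  then have "8 * M \<le> 4 * (n + (M + 1))" using D(1) by (metis mult_le_cancel1)
  then have "M + 1 \<le> 3 * n" using n1 by presburger
  have "card E < K * (M + 1)"
    using D(3) dividend_less_div_times[of K "card E"] by (simp add: M_def algebra_simps)
  also have "\<dots> \<le> K * (3 * n)" using \<open>M + 1 \<le> 3 * n\<close> by (rule mult_le_mono2)
  also have "\<dots> = 192 * 24 ^ (2 * q ^ 3) * n"
    by (simp add: K_def Q_def D_def mult_2 power_add)
  finally show ?thesis by simp
qed simp

text \<open>Thinning on the right and then on the left costs a factor \<open>q\<close> each; the
  condition obtained first survives in the smaller set.\<close>

lemma card_edges:
  assumes n: "card (right.vertex ` E) \<le> n" "card (left.vertex ` E) \<le> n"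
  shows "card E \<le> 192 * q\<^sup>2 * 24 ^ (2 * q ^ 3) * n"
proof -
  obtain F where F: "F \<subseteq> E" "card E \<le> card F * q"
    "\<And>e f. e \<in> F \<Longrightarrow> f \<in> F \<Longrightarrow> e \<noteq> f \<Longrightarrow> right.vertex e = right.vertex f \<Longrightarrow> \<not> right.cross e f"
    using right.thin_vertices by blast
  interpret F: crossing_line F X r y q X' r' y' by (rule crossing_line_subset[OF F(1)])
  obtain G where G: "G \<subseteq> F" "card F \<le> card G * q"
    "\<And>e f. e \<in> G \<Longrightarrow> f \<in> G \<Longrightarrow> e \<noteq> f \<Longrightarrow> left.vertex e = left.vertex f \<Longrightarrow> \<not> left.cross e f"
    using F.left.thin_vertices by blast
  interpret G: crossing_line G X r y q X' r' y' by (rule F.crossing_line_subset[OF G(1)])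
  have "card (v ` G) \<le> card (v ` E)" for v :: "'e \<Rightarrow> real \<times> real"
    using F(1) G(1) right.fin by (intro card_mono) auto
  then have "card G \<le> 192 * 24 ^ (2 * q ^ 3) * n"
    using F(3) G(1,3) n by (intro G.card_thin) (auto intro: order_trans)
  then have "card G * q * q \<le> 192 * 24 ^ (2 * q ^ 3) * n * q * q" by (intro mult_le_mono1)
  moreover have "card E \<le> card G * q * q" using F(2) G(2) by (meson le_trans mult_le_mono1)
  ultimately have "card E \<le> 192 * 24 ^ (2 * q ^ 3) * n * q * q" by (rule order_trans[rotated])
  then show ?thesis by (simp only: power2_eq_square mult_ac)
qed

end

subsection \<open>Drawings with x-monotone edges\<close>

text \<open>The abscissa is continuous and injective along the arc, so it maps the parameter
  interval monotonically onto \<open>{l..r}\<close>. By compactness its inverse on the arc is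
  continuous, and \<open>Y\<close> is the second coordinate of that inverse.\<close>

lemma x_monotone_arc_graph:
  assumes "arc g" "x_monotone (path_image g)"
  obtains l r Y where "l < r" "continuous_on {l..r} Y"
    "path_image g = (\<lambda>x. (x, Y x)) ` {l..r}" "arc_interior g = (\<lambda>x. (x, Y x)) ` {l<..<r}"
    "{pathstart g, pathfinish g} = {(l, Y l), (r, Y r)}"
proof -
  define f where "f = (\<lambda>t. fst (g t))"
  have cg: "continuous_on {0..1} g" and ig: "inj_on g {0..1}"
    using assms(1) by (auto simp: arc_def path_def)
  have cf: "continuous_on {0..1} f" unfolding f_def by (intro continuous_intros cg)
  have injC: "inj_on fst (path_image g)"
    using assms(2) by (auto simp: x_monotone_def inj_on_def)
  have "inj_on (fst \<circ> g) {0..1}"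
    using comp_inj_on[OF ig] injC by (simp add: path_image_def)
  then have jf: "inj_on f {0..1}" by (simp add: f_def comp_def)
  define l where "l = min (f 0) (f 1)"
  define r where "r = max (f 0) (f 1)"
  have "f 0 \<noteq> f 1" using inj_onD[OF jf, of 0 1] by auto
  then have lr: "l < r" by (auto simp: l_def r_def)
  have inside: "f t \<in> {l<..<r}" if "t \<in> {0<..<1}" for t
    using continuous_inj_imp_mono[of 0 t 1 f] cf jf that by (auto simp: l_def r_def)
  have f01: "f 0 \<in> {l, r}" "f 1 \<in> {l, r}" by (auto simp: l_def r_def min_def max_def)
  have "connected (f ` {0..1})" by (intro connected_continuous_image cf) simp
  moreover have "l \<in> f ` {0..1}" "r \<in> f ` {0..1}" by (auto simp: l_def r_def min_def max_def)
  ultimately have sup: "{l..r} \<subseteq> f ` {0..1}" by (rule connected_contains_Icc)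
  have split01: "{0..1::real} = {0<..<1} \<union> {0, 1}" by auto
  have img: "f ` {0..1} = {l..r}"
  proof
    show "f ` {0..1} \<subseteq> {l..r}"
      unfolding split01 using inside f01 lr by (fastforce simp: less_imp_le)
  qed (rule sup)
  have imgo: "f ` {0<..<1} = {l<..<r}"
  proof
    show "{l<..<r} \<subseteq> f ` {0<..<1}"
    proof
      fix x assume x: "x \<in> {l<..<r}"
      then have "x \<in> f ` {0..1}" using subsetD[OF sup, of x] by simp
      then obtain t where "t \<in> {0..1}" "x = f t" by blast
      moreover have "t \<noteq> 0" "t \<noteq> 1" using x f01 \<open>x = f t\<close> by auto
      ultimately show "x \<in> f ` {0<..<1}" by auto
    qed
  qed (use inside in blast)
  have fimg: "fst ` path_image g = {l..r}"
    using img by (simp add: path_image_def image_image f_def)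
  have "compact (path_image g)" using assms(1) by (simp add: compact_arc_image)
  then obtain h where h: "homeomorphism (path_image g) {l..r} fst h"
    using homeomorphism_compact[of "path_image g" fst "{l..r}"] injC fimg
      continuous_on_fst[OF continuous_on_id] by blast
  define Y where "Y = (\<lambda>x. snd (h x))"
  have cY: "continuous_on {l..r} Y"
    unfolding Y_def by (intro continuous_on_snd) (use h in \<open>simp add: homeomorphism_def\<close>)
  have gp: "g t = (f t, Y (f t))" if "t \<in> {0..1}" for t
  proof -
    have "g t \<in> path_image g" using that by (simp add: path_image_def)
    then have "h (fst (g t)) = g t" using h by (simp add: homeomorphism_def)
    then show ?thesis by (simp add: Y_def f_def prod_eq_iff)
  qed
  show thesis
  proof (rule that[OF lr cY])
    show "path_image g = (\<lambda>x. (x, Y x)) ` {l..r}"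
      unfolding img[symmetric] path_image_def image_image using gp by (intro image_cong) auto
    show "arc_interior g = (\<lambda>x. (x, Y x)) ` {l<..<r}"
      unfolding imgo[symmetric] arc_interior_def image_image using gp by (intro image_cong) auto
    show "{pathstart g, pathfinish g} = {(l, Y l), (r, Y r)}"
      using gp[of 0] gp[of 1] \<open>f 0 \<noteq> f 1\<close>
      by (auto simp: pathstart_def pathfinish_def l_def r_def min_def max_def)
  qed
qed

text \<open>\<open>X\<close> is the least abscissa with at least half of the points weakly to its
  left. Membership in \<open>S\<close> bounds the right side, minimality the left side.\<close>

lemma median_abscissa:
  fixes W :: "(real \<times> real) set"
  assumes "finite W" "W \<noteq> {}"
  obtains X where "2 * card {v \<in> W. fst v < X} \<le> card W" "2 * card {v \<in> W. X < fst v} \<le> card W"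
proof -
  define S where "S = {x \<in> fst ` W. card W \<le> 2 * card {v \<in> W. fst v \<le> x}}"
  have finS: "finite S" using assms by (simp add: S_def)
  have "{v \<in> W. fst v \<le> Max (fst ` W)} = W" using assms by (auto intro: Max_ge)
  then have "Max (fst ` W) \<in> S" using assms by (auto simp: S_def intro!: Max_in)
  then have ne: "S \<noteq> {}" by auto
  define X where "X = Min S"
  have XS: "X \<in> S" unfolding X_def using finS ne by (rule Min_in)
  have "2 * card {v \<in> W. fst v < X} \<le> card W"
  proof (cases "{v \<in> W. fst v < X} = {}")
    case False
    define A where "A = fst ` {v \<in> W. fst v < X}"
    have A: "finite A" "A \<noteq> {}" using assms False by (auto simp: A_def)
    have mA: "Max A \<in> A" using A by (rule Max_in)
    then have "Max A < X" "Max A \<in> fst ` W" by (auto simp: A_def)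
    moreover have "Max A \<notin> S"
      using Min_le[OF finS, of "Max A"] \<open>Max A < X\<close> by (auto simp: X_def)
    ultimately have "2 * card {v \<in> W. fst v \<le> Max A} < card W" by (simp add: S_def)
    moreover have "{v \<in> W. fst v < X} = {v \<in> W. fst v \<le> Max A}"
      using \<open>Max A < X\<close> Max_ge[OF A(1)] by (auto simp: A_def)
    ultimately show ?thesis by simp
  next
    case True
    then show ?thesis by (simp only: card.empty)
  qed
  moreover have "2 * card {v \<in> W. X < fst v} \<le> card W"
  proof -
    have "card W = card ({v \<in> W. fst v \<le> X} \<union> {v \<in> W. X < fst v})"
      by (rule arg_cong[of _ _ card]) auto
    also have "\<dots> = card {v \<in> W. fst v \<le> X} + card {v \<in> W. X < fst v}"
      by (rule card_Un_disjoint) (use assms in auto)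
    finally show ?thesis using XS by (simp add: S_def)
  qed
  ultimately show thesis using that by blast
qed

text \<open>This shifts the median line slightly off the vertices, so that edges with an end on the
  median still cross a nearby line strictly.\<close>

lemma finite_gap_below:
  fixes X :: real
  assumes "finite A"
  shows "\<exists>z<X. \<forall>a\<in>A. a < X \<longrightarrow> a < z"
  using assms
proof induction
  case empty
  show ?case by (intro exI[of _ "X - 1"]) simp
next
  case (insert a A)
  then obtain z where z: "z < X" "\<forall>a\<in>A. a < X \<longrightarrow> a < z" by blast
  show ?case
  proof (cases "a < X")
    case True
    with z show ?thesis by (intro exI[of _ "max z ((a + X) / 2)"]) (auto simp: less_max_iff_disj)
  next
    case False
    with z show ?thesis by blast
  qed
qed

lemma finite_gap_above:
  fixes X :: real
  assumes "finite A"
  shows "\<exists>z>X. \<forall>a\<in>A. X < a \<longrightarrow> z < a"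
proof -
  obtain z where "z < - X" "\<forall>a\<in>uminus ` A. a < - X \<longrightarrow> a < z"
    using finite_gap_below[of "uminus ` A" "- X"] assms by auto
  then show ?thesis by (intro exI[of _ "- z"]) auto
qed

text \<open>Halving lowers the logarithm by one, which pays for the linear term of the recursion.
  For \<open>m = 0\<close> both sides vanish.\<close>

lemma halving_log_bound:
  fixes m n :: nat
  assumes "2 * m \<le> n" "0 < n"
  shows "m * log 2 m \<le> m * (log 2 n - 1)"
proof (cases "m = 0")
  case False
  then have "log 2 (real m) \<le> log 2 (real n / 2)" using assms by simp
  also have "\<dots> = log 2 n - 1" using assms by (simp add: log_divide)
  finally show ?thesis by (simp add: mult_left_mono)
qed simp

section \<open>Edge counts in a drawing whose edges are function graphs\<close>

locale x_monotone_drawing =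
  fixes V :: "point set" and E :: "point set set" and \<gamma> :: "point set \<Rightarrow> real \<Rightarrow> point" and k :: nat
    and lx rx :: "point set \<Rightarrow> real" and Y :: "point set \<Rightarrow> real \<Rightarrow> real"
  assumes graph: "topological_graph V E \<gamma>" and quasi: "quasi_planar k E \<gamma>" and k: "1 \<le> k"
    and lx_less: "\<And>e. e \<in> E \<Longrightarrow> lx e < rx e"
    and cont: "\<And>e. e \<in> E \<Longrightarrow> continuous_on {lx e..rx e} (Y e)"
    and image: "\<And>e. e \<in> E \<Longrightarrow> path_image (\<gamma> e) = (\<lambda>x. (x, Y e x)) ` {lx e..rx e}"
    and interior: "\<And>e. e \<in> E \<Longrightarrow> arc_interior (\<gamma> e) = (\<lambda>x. (x, Y e x)) ` {lx e<..<rx e}"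
    and ends: "\<And>e. e \<in> E \<Longrightarrow> e = {(lx e, Y e (lx e)), (rx e, Y e (rx e))}"
begin

lemma finV: "finite V" using graph by (simp add: topological_graph_def)

lemma edge_sub: "e \<in> E \<Longrightarrow> e \<subseteq> V" using graph by (simp add: topological_graph_def)

lemma finE: "finite E"
  by (rule finite_subset[of _ "Pow V"]) (use edge_sub finV in auto)

lemma edges_crossI:
  assumes "e \<in> E" "f \<in> E" "lx e < x" "x < rx e" "lx f < x" "x < rx f" "Y e x = Y f x"
  shows "edges_cross \<gamma> e f"
proof -
  have "(x, Y e x) \<in> arc_interior (\<gamma> e)" "(x, Y e x) \<in> arc_interior (\<gamma> f)"
    unfolding interior[OF assms(1)] interior[OF assms(2)] using assms by auto
  then show ?thesis by (auto simp: edges_cross_def)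
qed

lemma avoids_vertex:
  assumes "e \<in> E" "v \<in> V" "lx e < fst v" "fst v < rx e"
  shows "Y e (fst v) \<noteq> snd v"
proof
  assume "Y e (fst v) = snd v"
  then have "v \<in> path_image (\<gamma> e) \<inter> V"
    unfolding image[OF assms(1)] using assms by (auto simp: image_iff prod_eq_iff intro!: bexI[of _ "fst v"])
  also have "\<dots> = e" using graph assms(1) by (simp add: topological_graph_def)
  finally have "v \<in> {(lx e, Y e (lx e)), (rx e, Y e (rx e))}" using ends[OF assms(1)] by simp
  then show False using assms(3,4) by auto
qed

lemma card_pairwise_crossing:
  assumes "F \<subseteq> E" "pairwise (edges_cross \<gamma>) F"
  shows "card F \<le> k - 1"
proof (rule ccontr)
  assume "\<not> card F \<le> k - 1"
  then have "k \<le> card F" by simp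
  then obtain G where G: "G \<subseteq> F" "card G = k" using obtain_subset_with_card_n by metis
  then have "pairwise (edges_cross \<gamma>) G" using assms(2) pairwise_subset by blast
  moreover have "G \<subseteq> E" using G(1) assms(1) by (rule subset_trans)
  ultimately show False using quasi G(2) unfolding quasi_planar_def by blast
qed

text \<open>As \<open>X\<close> lies strictly between the ends of each edge, a common point from
  \<open>X\<close> up to but excluding the right ends is interior to both edges, so cliques have at
  most \<open>k - 1\<close> members. The left side follows by the reflection of \<open>x\<close> to
  \<open>- x\<close>.\<close>

lemma card_edges_crossing_line:
  assumes W: "W \<subseteq> V"
  shows "card {e \<in> E. e \<subseteq> W \<and> lx e < X \<and> X < rx e} \<le>
    192 * (k - 1)\<^sup>2 * 24 ^ (2 * (k - 1) ^ 3) * card W"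
proof -
  define F where "F = {e \<in> E. e \<subseteq> W \<and> lx e < X \<and> X < rx e}"
  have FE: "e \<in> E" if "e \<in> F" for e using that by (simp add: F_def)
  have F: "lx e < X" "X < rx e" "(lx e, Y e (lx e)) \<in> W" "(rx e, Y e (rx e)) \<in> W" if "e \<in> F" for e
    using that ends[of e] by (auto simp: F_def)
  have finF: "finite F" using finE by (simp add: F_def)
  have finW: "finite W" using W finV finite_subset by blast
  interpret R: right_curves F X rx Y "k - 1"
  proof
    show "continuous_on {X..rx e} (Y e)" if "e \<in> F" for e
      by (rule continuous_on_subset[OF cont[OF FE[OF that]]]) (use F[OF that] in auto)
    show "Y f (rx e) \<noteq> Y e (rx e)" if "e \<in> F" "f \<in> F" "rx e < rx f" for e f
    proof -
      have "(rx e, Y e (rx e)) \<in> V" using F(4)[OF that(1)] W by blast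
      from avoids_vertex[OF FE[OF that(2)] this] that F(2)[OF that(1)] F(1)[OF that(2)]
      show ?thesis by simp
    qed
    show "card G \<le> k - 1" if G: "G \<subseteq> F"
      "pairwise (\<lambda>e f. \<exists>x. X \<le> x \<and> x < rx e \<and> x < rx f \<and> Y e x = Y f x) G" for G
    proof (rule card_pairwise_crossing)
      show "pairwise (edges_cross \<gamma>) G"
      proof (rule pairwiseI)
        fix e f assume ef: "e \<in> G" "f \<in> G" "e \<noteq> f"
        obtain x where "X \<le> x" "x < rx e" "x < rx f" "Y e x = Y f x"
          using pairwiseD[OF G(2) ef] by blast
        moreover have eF: "e \<in> F" "f \<in> F" using ef G(1) by auto
        ultimately show "edges_cross \<gamma> e f" 
          using F(1)[OF eF(1)] F(1)[OF eF(2)] FE[OF eF(1)] FE[OF eF(2)]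
          by (intro edges_crossI[of e f x]) auto
      qed
    qed (use G FE in blast)
  qed (use finF F in auto)
  interpret L: right_curves F "- X" "\<lambda>e. - lx e" "\<lambda>e x. Y e (- x)" "k - 1"
  proof
    show "continuous_on {- X..- lx e} (\<lambda>x. Y e (- x))" if "e \<in> F" for e
    proof (rule continuous_on_compose2[OF cont[OF FE[OF that]]])
      show "uminus ` {- X..- lx e} \<subseteq> {lx e..rx e}" using F[OF that] by auto
    qed (intro continuous_intros)
    show "Y f (- (- lx e)) \<noteq> Y e (- (- lx e))" if "e \<in> F" "f \<in> F" "- lx e < - lx f" for e f
    proof -
      have "(lx e, Y e (lx e)) \<in> V" using F(3)[OF that(1)] W by blast
      from avoids_vertex[OF FE[OF that(2)] this] that F(1)[OF that(1)] F(2)[OF that(2)]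
      show ?thesis by simp
    qed
    show "card G \<le> k - 1" if G: "G \<subseteq> F"
      "pairwise (\<lambda>e f. \<exists>x. - X \<le> x \<and> x < - lx e \<and> x < - lx f \<and> Y e (- x) = Y f (- x)) G" for G
    proof (rule card_pairwise_crossing)
      show "pairwise (edges_cross \<gamma>) G"
      proof (rule pairwiseI)
        fix e f assume ef: "e \<in> G" "f \<in> G" "e \<noteq> f"
        obtain x where "- X \<le> x" "x < - lx e" "x < - lx f" "Y e (- x) = Y f (- x)"
          using pairwiseD[OF G(2) ef] by blast
        moreover have eF: "e \<in> F" "f \<in> F" using ef G(1) by auto
        ultimately show "edges_cross \<gamma> e f" 
          using F(2)[OF eF(1)] F(2)[OF eF(2)] FE[OF eF(1)] FE[OF eF(2)]
          by (intro edges_crossI[of e f "- x"]) auto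
      qed
    qed (use G FE in blast)
  qed (use finF F in auto)
  interpret crossing_line F X rx Y "k - 1" "- X" "\<lambda>e. - lx e" "\<lambda>e x. Y e (- x)"
  proof
    \<comment> \<open>An edge is the set of its two ends, so its right and left ends determine
      it.\<close>
    show "inj_on (\<lambda>e. (R.vertex e, L.vertex e)) F"
    proof (rule inj_onI)
      fix e f assume ef: "e \<in> F" "f \<in> F" "(R.vertex e, L.vertex e) = (R.vertex f, L.vertex f)"
      have same: "(lx e, Y e (lx e)) = (lx f, Y f (lx f))" "(rx e, Y e (rx e)) = (rx f, Y f (rx f))"
        using ef(3) unfolding R.vertex_def L.vertex_def prod.inject minus_minus neg_equal_iff_equal
        by blast+
      have "e = {(lx e, Y e (lx e)), (rx e, Y e (rx e))}" by (rule ends[OF FE[OF ef(1)]])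
      also have "\<dots> = {(lx f, Y f (lx f)), (rx f, Y f (rx f))}" by (simp only: same)
      also have "\<dots> = f" by (rule ends[OF FE[OF ef(2)], symmetric])
      finally show "e = f" .
    qed
  qed simp
  have "R.vertex ` F \<subseteq> W" using F(4) by (auto simp: R.vertex_def)
  then have "card (R.vertex ` F) \<le> card W" using finW card_mono by blast
  moreover have "L.vertex ` F \<subseteq> (\<lambda>v. (- fst v, snd v)) ` W"
    using F(3) by (force simp: L.vertex_def)
  then have "card (L.vertex ` F) \<le> card W" using finW surj_card_le by blast
  ultimately show ?thesis using card_edges unfolding F_def by blast
qed

text \<open>Divide and conquer at the median: edges inside one of the two halves are counted by
  induction, all others cross one of two lines, each crossed by at most \<open>C * n\<close>
  edges.\<close>

lemma card_edges_within:
  defines "C \<equiv> real (192 * (k - 1)\<^sup>2 * 24 ^ (2 * (k - 1) ^ 3))"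
  assumes "W \<subseteq> V"
  shows "card {e \<in> E. e \<subseteq> W} \<le> 2 * C * (card W * log 2 (card W))"
  using assms(2)
proof (induction "card W" arbitrary: W rule: less_induct)
  case less
  have finW: "finite W" using less.prems finV finite_subset by blast
  define n where "n = card W"
  define N where "N U = card {e \<in> E. e \<subseteq> U}" for U :: "point set"
  have C0: "0 \<le> C" by (simp add: C_def)
  show ?case
  proof (cases "n < 2")
    case True
    have "\<not> e \<subseteq> W" if "e \<in> E" for e
    proof
      assume "e \<subseteq> W"
      then have "card e \<le> n" unfolding n_def using finW card_mono by blast
      moreover have "card e = 2" using graph that by (simp add: topological_graph_def)
      ultimately show False using True by simp
    qed
    then have none: "{e \<in> E. e \<subseteq> W} = {}" by blast
    have "0 \<le> real n * log 2 n" using True by (cases "n = 0") auto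
    then show ?thesis unfolding none using C0 by (simp add: n_def)
  next
    case False
    then have n2: "2 \<le> n" by simp
    then have "W \<noteq> {}" by (auto simp: n_def)
    then obtain X where X: "2 * card {v \<in> W. fst v < X} \<le> n" "2 * card {v \<in> W. X < fst v} \<le> n"
      using median_abscissa finW unfolding n_def by blast
    define W1 where "W1 = {v \<in> W. fst v < X}"
    define W2 where "W2 = {v \<in> W. X < fst v}"
    obtain X1 where X1: "X1 < X" "\<And>v. v \<in> W \<Longrightarrow> fst v < X \<Longrightarrow> fst v < X1"
      using finite_gap_below[of "fst ` W" X] finW by auto
    obtain X2 where X2: "X < X2" "\<And>v. v \<in> W \<Longrightarrow> X < fst v \<Longrightarrow> X2 < fst v"
      using finite_gap_above[of "fst ` W" X] finW by auto
    define L where "L Z = {e \<in> E. e \<subseteq> W \<and> lx e < Z \<and> Z < rx e}" for Z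
    have cover: "{e \<in> E. e \<subseteq> W} \<subseteq> {e \<in> E. e \<subseteq> W1} \<union> {e \<in> E. e \<subseteq> W2} \<union> L X1 \<union> L X2"
    proof
      fix e assume "e \<in> {e \<in> E. e \<subseteq> W}"
      then have e: "e \<in> E" "e \<subseteq> W" by auto
      note le = lx_less[OF e(1)] and ee = ends[OF e(1)]
      have inW: "(lx e, Y e (lx e)) \<in> W" "(rx e, Y e (rx e)) \<in> W" using ee e(2) by auto
      \<comment> \<open>Edges from the left that reach the median cross the line at
        \<open>X1\<close>; edges starting on the median cross the line at \<open>X2\<close>.\<close>
      consider "rx e < X" | "X < lx e" | "lx e < X" "X \<le> rx e" | "lx e = X" by linarith
      then show "e \<in> {e \<in> E. e \<subseteq> W1} \<union> {e \<in> E. e \<subseteq> W2} \<union> L X1 \<union> L X2"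
      proof cases
        case 1
        then have "{(lx e, Y e (lx e)), (rx e, Y e (rx e))} \<subseteq> W1" using inW le by (simp add: W1_def)
        then show ?thesis using e ee by simp
      next
        case 2
        then have "{(lx e, Y e (lx e)), (rx e, Y e (rx e))} \<subseteq> W2" using inW le by (simp add: W2_def)
        then show ?thesis using e ee by simp
      next
        case 3
        then have "e \<in> L X1" using X1(1) X1(2)[OF inW(1)] e by (simp add: L_def)
        then show ?thesis by simp
      next
        case 4
        then have "e \<in> L X2" using X2(1) X2(2)[OF inW(2)] le e by (simp add: L_def)
        then show ?thesis by simp
      qed
    qed
    have "N W \<le> card ({e \<in> E. e \<subseteq> W1} \<union> {e \<in> E. e \<subseteq> W2} \<union> L X1 \<union> L X2)"
      unfolding N_def by (rule card_mono[OF _ cover]) (use finE in \<open>simp add: L_def\<close>)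
    also have "\<dots> \<le> N W1 + N W2 + card (L X1) + card (L X2)"
      unfolding N_def by (meson add_le_mono1 card_Un_le order_trans)
    finally have "real (N W) \<le> N W1 + N W2 + card (L X1) + card (L X2)" by linarith
    moreover have LC: "real (card (L Z)) \<le> C * n" for Z
    proof -
      have "real (card (L Z)) \<le> real (192 * (k - 1)\<^sup>2 * 24 ^ (2 * (k - 1) ^ 3) * card W)"
        unfolding L_def by (intro of_nat_mono card_edges_crossing_line less.prems)
      then show ?thesis unfolding C_def n_def of_nat_mult .
    qed
    moreover have small: "card W1 < card W" "card W2 < card W"
      using X n2 unfolding W1_def W2_def n_def by linarith+
    have sub: "W1 \<subseteq> V" "W2 \<subseteq> V" using less.prems by (auto simp: W1_def W2_def)
    have "real (N W1) \<le> 2 * C * (card W1 * log 2 (card W1))"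
      unfolding N_def by (rule less.hyps[OF small(1) sub(1)])
    moreover have "real (N W2) \<le> 2 * C * (card W2 * log 2 (card W2))"
      unfolding N_def by (rule less.hyps[OF small(2) sub(2)])
    moreover have "2 * C * (card W1 * log 2 (card W1)) \<le> 2 * C * (card W1 * (log 2 n - 1))"
      "2 * C * (card W2 * log 2 (card W2)) \<le> 2 * C * (card W2 * (log 2 n - 1))"
      by (intro mult_left_mono halving_log_bound; use X n2 C0 in \<open>simp add: W1_def W2_def\<close>)+
    ultimately have "real (N W) \<le> 2 * C * (card W1 * (log 2 n - 1)) + 2 * C * (card W2 * (log 2 n - 1)) + 2 * (C * n)"
      using LC[of X1] LC[of X2] by linarith
    also have "\<dots> = 2 * C * (real (card W1 + card W2) * (log 2 n - 1) + n)"
      by (simp add: algebra_simps)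
    \<comment> \<open>Vertices on the median belong to neither half, so the halves may have fewer
      than \<open>n\<close> vertices together; the factor \<open>log 2 n - 1\<close> is nonnegative
      as \<open>n \<ge> 2\<close>.\<close>
    also have "\<dots> \<le> 2 * C * (n * (log 2 n - 1) + n)"
    proof -
      have "card W1 + card W2 \<le> n" using X unfolding W1_def W2_def by linarith
      moreover have "1 \<le> log 2 n" using n2 by (simp add: le_log_iff)
      ultimately have "real (card W1 + card W2) * (log 2 n - 1) \<le> n * (log 2 n - 1)"
        by (intro mult_right_mono) auto
      then show ?thesis using C0 by (intro mult_left_mono) auto
    qed
    also have "\<dots> = 2 * C * (n * log 2 n)" by (simp add: algebra_simps)
    finally show ?thesis by (simp add: N_def n_def)
  qed
qed

end

text \<open>The exponent 20 is 9 + 1 + 10, from \<open>384 \<le> 2 ^ 9\<close>,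
  \<open>(k - 1)\<^sup>2 \<le> 2 ^ (k ^ 3)\<close> and \<open>24 \<le> 2 ^ 5\<close>.\<close>

lemma constant_bound:
  assumes "1 \<le> k"
  shows "2 * real (192 * (k - 1)\<^sup>2 * 24 ^ (2 * (k - 1) ^ 3)) \<le> 2 powr (20 * real k ^ 3)"
proof -
  have k3: "(k - 1) ^ 3 \<le> k ^ 3" by (simp add: power_mono)
  have "1 \<le> k ^ 3" using assms by simp
  then have "(2::nat) ^ 9 \<le> 2 ^ (9 * k ^ 3)" by (intro power_increasing) auto
  then have A: "2 * 192 \<le> (2::nat) ^ (9 * k ^ 3)" by simp
  have "(k - 1)\<^sup>2 \<le> k\<^sup>2" by (simp add: power_mono)
  also have "\<dots> \<le> k ^ 3" using assms by (intro power_increasing) auto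
  also have "\<dots> \<le> 2 ^ (k ^ 3)" by (simp add: less_imp_le)
  finally have B: "(k - 1)\<^sup>2 \<le> 2 ^ (k ^ 3)" .
  have "(24::nat) ^ (2 * (k - 1) ^ 3) \<le> (2 ^ 5) ^ (2 * (k - 1) ^ 3)" by (intro power_mono) auto
  also have "\<dots> \<le> (2 ^ 5) ^ (2 * k ^ 3)" using k3 by (intro power_increasing) auto
  also have "\<dots> = 2 ^ (10 * k ^ 3)" unfolding power_mult[symmetric] by simp
  finally have "(2 * 192) * (k - 1)\<^sup>2 * 24 ^ (2 * (k - 1) ^ 3) \<le>
      (2::nat) ^ (9 * k ^ 3) * 2 ^ (k ^ 3) * 2 ^ (10 * k ^ 3)"
    by (intro mult_le_mono A B)
  also have "\<dots> = 2 ^ (20 * k ^ 3)" unfolding power_add[symmetric] by simp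
  finally have "real ((2 * 192) * (k - 1)\<^sup>2 * 24 ^ (2 * (k - 1) ^ 3)) \<le> real (2 ^ (20 * k ^ 3))"
    by (rule of_nat_mono)
  also have "real (2 ^ (20 * k ^ 3)) = 2 powr (20 * real k ^ 3)"
    using powr_realpow[of "2::real" "20 * k ^ 3"] by simp
  finally show ?thesis by (simp add: mult.assoc)
qed

theorem theorem2:
  shows "\<exists>c::real. \<forall>k::nat. k \<ge> 2 \<longrightarrow>
    (\<forall>(V :: point set) (E :: point set set) (\<gamma> :: point set \<Rightarrow> real \<Rightarrow> point) (n :: nat).
       topological_graph V E \<gamma> \<and> card V = n \<and> quasi_planar k E \<gamma> \<and>
       (\<forall>e\<in>E. x_monotone (path_image (\<gamma> e))) \<longrightarrow>
       real (card E) \<le> 2 powr (c * real k ^ 3) * real n * log 2 (real n))"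
proof (intro exI[of _ 20] allI impI, elim conjE)
  fix k n :: nat and V :: "point set" and E :: "point set set" and \<gamma> :: "point set \<Rightarrow> real \<Rightarrow> point"
  assume k: "2 \<le> k" and G: "topological_graph V E \<gamma>" and n: "card V = n"
    and Q: "quasi_planar k E \<gamma>" and mono: "\<forall>e\<in>E. x_monotone (path_image (\<gamma> e))"
  \<comment> \<open>One predicate for all properties lets the ends and the height function be chosen
    together for each edge.\<close>
  define draws where "draws e l r Y \<longleftrightarrow> l < r \<and> continuous_on {l..r} Y \<and>
      path_image (\<gamma> e) = (\<lambda>x. (x, Y x)) ` {l..r} \<and>
      arc_interior (\<gamma> e) = (\<lambda>x. (x, Y x)) ` {l<..<r} \<and> e = {(l, Y l), (r, Y r)}"
    for e and l r :: real and Y :: "real \<Rightarrow> real"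
  have "\<exists>l r Y. draws e l r Y" if e: "e \<in> E" for e
  proof -
    have "arc (\<gamma> e)" and ends: "{pathstart (\<gamma> e), pathfinish (\<gamma> e)} = e"
      using G e by (simp_all add: topological_graph_def)
    show ?thesis unfolding draws_def
      by (rule x_monotone_arc_graph[OF \<open>arc (\<gamma> e)\<close> mono[rule_format, OF e], unfolded ends]) blast
  qed
  then obtain lx rx Y where draws: "\<And>e. e \<in> E \<Longrightarrow> draws e (lx e) (rx e) (Y e)"
    by metis
  note D = draws[unfolded draws_def]
  interpret x_monotone_drawing V E \<gamma> k lx rx Y
  proof
    show "lx e < rx e" "continuous_on {lx e..rx e} (Y e)"
      "path_image (\<gamma> e) = (\<lambda>x. (x, Y e x)) ` {lx e..rx e}"
      "arc_interior (\<gamma> e) = (\<lambda>x. (x, Y e x)) ` {lx e<..<rx e}"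
      "e = {(lx e, Y e (lx e)), (rx e, Y e (rx e))}" if "e \<in> E" for e
      using D[OF that] by blast+
  qed (use G Q k in auto)
  have "{e \<in> E. e \<subseteq> V} = E" using edge_sub by auto
  then have "real (card E) \<le>
      2 * real (192 * (k - 1)\<^sup>2 * 24 ^ (2 * (k - 1) ^ 3)) * (n * log 2 n)"
    using card_edges_within[of V] n by simp
  also have "\<dots> \<le> 2 powr (20 * real k ^ 3) * (n * log 2 n)"
  proof (rule mult_right_mono)
    show "0 \<le> n * log 2 n" by (cases "n = 0") auto
  qed (use constant_bound k in simp)
  finally show "real (card E) \<le> 2 powr (20 * real k ^ 3) * real n * log 2 (real n)"
    by (simp add: mult.assoc)
qed

end
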